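(* The following hold for the functions $\eta^{(j)}_*(\mu)$ and $\beta^{(i,j)}(\mu)$ defined in the context. 1. $\beta^{(i,j)}(\mu)\ge 0$ for every $\mu\in\mathcal D$ and every $i\in\{1,\dots,j\}$. 2. $\eta^{(j)}_*(\mu_i)\ge\lambda^{(i)}_1$ for every $i\in\{1,\dots,j\}$. 3. For every $i\in\{1,\dots,j\}$, if $\lambda^{(i)}_1$ is a simple eigenvalue of $A(\mu_i)$, then $\beta^{(i,j)}(\mu_i)>0$. 4. For every $i\in\{1,\dots,j\}$, if $\lambda^{(i)}_1$ is a simple eigenvalue of $A(\mu_i)$, then $\eta^{(j)}_*(\mu_i)>\lambda^{(i)}_1$. 5. For every $i\in\{1,\dots,j\}$, if $\lambda^{(i)}_{r+1}>\lambda^{(i)}_r$, then $\beta^{(i,j)}(\mu_i)=\lambda^{(i)}_{r+1}-\lambda^{(i)}_1>0$. 6. For every $i\in\{1,\dots,j\}$, if $\lambda^{(i)}_{r+1}>\lambda^{(i)}_r$, then $\eta^{(j)}_*(\mu_i)\ge\lambda^{(i)}_{r+1}$.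
   Context: Let $\mathcal D\subset\mathbb R^p$ be compact and $A(\mu)=\sum_{m=1}^{\kappa}\theta_m(\mu)A_m$ with $A_m\in\mathbb C^{n\times n}$ Hermitian and $\theta_m:\mathbb R^p\to\mathbb R$ real analytic; put $\theta(\mu)=[\theta_1(\mu),\dots,\theta_\kappa(\mu)]^T$. Fix integers $1\le r\le \ell<n$ and points $\mu_1,\dots,\mu_j\in\mathcal D$. For $i=1,\dots,j$, let $\lambda^{(i)}_1\le\lambda^{(i)}_2\le\cdots$ be the eigenvalues of $A(\mu_i)$ in increasing order, counted with multiplicity, and let $v^{(i)}_1,\dots,v^{(i)}_\ell$ be orthonormal eigenvectors of $A(\mu_i)$ corresponding to $\lambda^{(i)}_1,\dots,\lambda^{(i)}_\ell$. Put $\Lambda^{(i)}=\mathrm{diag}(\lambda^{(i)}_1,\dots,\lambda^{(i)}_\ell)$ and $V^{(i)}=[v^{(i)}_1\cdots v^{(i)}_\ell]$. Set $\mathcal V_j=\mathrm{span}\{v^{(i)}_k: 1\le i\le j,\ 1\le k\le \ell\}$ and let $V_j$ be a matrix whose columns form an orthonormal basis of $\mathcal V_j$. For $\mu\in\mathcal D$, let $w^{V_j}_1(\mu),\dots,w^{V_j}_r(\mu)$ be orthonormal eigenvectors of $V_j^*A(\mu)V_j$ corresponding to its $r$ smallest eigenvalues, and $U_j(\mu)=[\,V_jw^{V_j}_1(\mu),\dots,V_jw^{V_j}_r(\mu)\,]$. Define, with $\lambda_{\min}$ denoting the smallest eigenvalue (the eigenvalues of the matrix below are real), $$\beta^{(i,j)}(\mu)=\lambda_{\min}\Big(\Lambda^{(i)}-\lambda^{(i)}_1I_\ell-[V^{(i)}]^*U_j(\mu)U_j(\mu)^*V^{(i)}\big(\Lambda^{(i)}-\lambda^{(i)}_{\ell+1}I_\ell\big)\Big).$$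 Let $\mathcal B=[\lambda_{\min}(A_1),\lambda_{\max}(A_1)]\times\cdots\times[\lambda_{\min}(A_\kappa),\lambda_{\max}(A_\kappa)]\subset\mathbb R^\kappa$, $$\mathcal Y^{(j)}_{\mathrm{LB}}(\mu)=\{y\in\mathcal B:\ \theta(\mu_i)^Ty\ge\lambda^{(i)}_1+\beta^{(i,j)}(\mu)\ \text{for all } i=1,\dots,j\},$$ and define $\eta^{(j)}_*(\mu)=\min\{\theta(\mu)^Ty:\ y\in\mathcal Y^{(j)}_{\mathrm{LB}}(\mu)\}$ (the feasible set is nonempty and compact). *)

theory Defs
  imports
    "HOL-Analysis.Analysis"
    "Jordan_Normal_Form.Spectral_Radius"
    "Jordan_Normal_Form.Schur_Decomposition"
begin

unbundle no vec_syntax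
notation vec_lambda (binder "\<chi>" 10)

definition real_analytic :: "(real ^ 'p \<Rightarrow> real) \<Rightarrow> bool" where
  "real_analytic f \<longleftrightarrow>
     (\<forall>a. \<exists>c :: ('p \<Rightarrow> nat) \<Rightarrow> real. \<exists>\<epsilon>>0. \<forall>x\<in>ball a \<epsilon>.
        ((\<lambda>\<alpha>. c \<alpha> * (\<Prod>i\<in>UNIV. (vec_nth x i - vec_nth a i) ^ \<alpha> i)) has_sum f x) UNIV)"

definition hermitian_mat :: "complex mat \<Rightarrow> bool" where
  "hermitian_mat M \<longleftrightarrow> mat_adjoint M = M"

text \<open>
  \<open>eig M k\<close> is the \<open>k\<close>-th smallest eigenvalue (\<open>1 \<le> k \<le> n\<close>), counted with algebraic
  multiplicity. Taking real parts only makes sense here because the definition is applied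
  to Hermitian matrices, whose spectrum is real.
\<close>

definition eig :: "complex mat \<Rightarrow> nat \<Rightarrow> real" where
  "eig M k = sorted_list_of_multiset (image_mset Re (proots (char_poly M))) ! (k - 1)"

definition simple_eigenvalue :: "complex mat \<Rightarrow> complex \<Rightarrow> bool" where
  "simple_eigenvalue M a \<longleftrightarrow> Polynomial.order a (char_poly M) = 1"

text \<open>Again only used for matrices all of whose eigenvalues are real, though not necessarily
  Hermitian ones.\<close>

definition lambda_min :: "complex mat \<Rightarrow> real" where
  "lambda_min M = Min (Re ` spectrum M)"

definition lambda_max :: "complex mat \<Rightarrow> real" where
  "lambda_max M = Max (Re ` spectrum M)"

definition orthonormal_on :: "nat \<Rightarrow> nat \<Rightarrow> (nat \<Rightarrow> complex vec) \<Rightarrow> bool" where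
  "orthonormal_on n q v \<longleftrightarrow>
     (\<forall>k\<in>{1..q}. v k \<in> carrier_vec n) \<and>
     (\<forall>k\<in>{1..q}. \<forall>k'\<in>{1..q}. v k \<bullet>c v k' = (if k = k' then 1 else 0))"

definition lowest_eigenvectors :: "complex mat \<Rightarrow> nat \<Rightarrow> (nat \<Rightarrow> complex vec) \<Rightarrow> bool" where
  "lowest_eigenvectors M q v \<longleftrightarrow>
     orthonormal_on (dim_row M) q v \<and>
     (\<forall>k\<in>{1..q}. eigenvector M (v k) (complex_of_real (eig M k)))"

definition cols_mat :: "nat \<Rightarrow> nat \<Rightarrow> (nat \<Rightarrow> complex vec) \<Rightarrow> complex mat" where
  "cols_mat n q v = mat_of_cols n (map v [1..<Suc q])"

definition vec_span :: "nat \<Rightarrow> complex vec set \<Rightarrow> complex vec set" where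
  "vec_span n S = LinearCombinations.module.span class_ring (module_vec TYPE(complex) n) S"

definition orthonormal_basis_mat :: "nat \<Rightarrow> complex mat \<Rightarrow> complex vec set \<Rightarrow> bool" where
  "orthonormal_basis_mat n V S \<longleftrightarrow>
     dim_row V = n \<and> mat_adjoint V * V = 1\<^sub>m (dim_col V) \<and> vec_span n (set (cols V)) = S"

definition A_of :: "nat \<Rightarrow> ('k::finite \<Rightarrow> real ^ 'p \<Rightarrow> real) \<Rightarrow> ('k \<Rightarrow> complex mat)
    \<Rightarrow> real ^ 'p \<Rightarrow> complex mat" where
  "A_of n \<theta> A \<mu> = mat n n (\<lambda>(a, b). \<Sum>m\<in>UNIV. complex_of_real (\<theta> m \<mu>) * A m $$ (a, b))"

definition theta_vec :: "('k::finite \<Rightarrow> real ^ 'p \<Rightarrow> real) \<Rightarrow> real ^ 'p \<Rightarrow> real ^ 'k" where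
  "theta_vec \<theta> \<mu> = (\<chi> m. \<theta> m \<mu>)"

definition beta_gap :: "nat \<Rightarrow> complex mat \<Rightarrow> complex mat \<Rightarrow> complex mat \<Rightarrow> real" where
  "beta_gap l M V U =
     (let \<Lambda> = mat_diag l (\<lambda>a. complex_of_real (eig M (a + 1))) in
      lambda_min
        (\<Lambda> - complex_of_real (eig M 1) \<cdot>\<^sub>m 1\<^sub>m l
         - mat_adjoint V * U * mat_adjoint U * V
             * (\<Lambda> - complex_of_real (eig M (l + 1)) \<cdot>\<^sub>m 1\<^sub>m l)))"

text \<open>
  Common parameters below: \<open>pts i\<close> is the \<open>i\<close>-th interpolation point, \<open>v i k\<close> the chosen
  \<open>k\<close>-th eigenvector there, \<open>V\<close> the subspace basis matrix and \<open>w \<mu> k\<close> the chosen \<open>k\<close>-th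
  eigenvector of the projected matrix at \<open>\<mu>\<close>.
\<close>

definition U_of :: "nat \<Rightarrow> nat \<Rightarrow> complex mat \<Rightarrow> (real ^ 'p \<Rightarrow> nat \<Rightarrow> complex vec)
    \<Rightarrow> real ^ 'p \<Rightarrow> complex mat" where
  "U_of n r V w \<mu> = cols_mat n r (\<lambda>k. V *\<^sub>v w \<mu> k)"

definition beta :: "nat \<Rightarrow> nat \<Rightarrow> nat \<Rightarrow> ('k::finite \<Rightarrow> real ^ 'p \<Rightarrow> real) \<Rightarrow> ('k \<Rightarrow> complex mat)
    \<Rightarrow> (nat \<Rightarrow> real ^ 'p) \<Rightarrow> (nat \<Rightarrow> nat \<Rightarrow> complex vec)
    \<Rightarrow> complex mat \<Rightarrow> (real ^ 'p \<Rightarrow> nat \<Rightarrow> complex vec) \<Rightarrow> nat \<Rightarrow> real ^ 'p \<Rightarrow> real" where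
  "beta n l r \<theta> A pts v V w i \<mu> =
     beta_gap l (A_of n \<theta> A (pts i)) (cols_mat n l (v i)) (U_of n r V w \<mu>)"

definition B_box :: "('k::finite \<Rightarrow> complex mat) \<Rightarrow> (real ^ 'k) set" where
  "B_box A = cbox (\<chi> m. lambda_min (A m)) (\<chi> m. lambda_max (A m))"

definition Y_LB :: "nat \<Rightarrow> nat \<Rightarrow> nat \<Rightarrow> nat \<Rightarrow> ('k::finite \<Rightarrow> real ^ 'p \<Rightarrow> real)
    \<Rightarrow> ('k \<Rightarrow> complex mat) \<Rightarrow> (nat \<Rightarrow> real ^ 'p) \<Rightarrow> (nat \<Rightarrow> nat \<Rightarrow> complex vec)
    \<Rightarrow> complex mat \<Rightarrow> (real ^ 'p \<Rightarrow> nat \<Rightarrow> complex vec) \<Rightarrow> real ^ 'p \<Rightarrow> (real ^ 'k) set" where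
  "Y_LB n l r j \<theta> A pts v V w \<mu> =
     {y \<in> B_box A. \<forall>i\<in>{1..j}.
        inner (theta_vec \<theta> (pts i)) y
          \<ge> eig (A_of n \<theta> A (pts i)) 1 + beta n l r \<theta> A pts v V w i \<mu>}"

text \<open>\<open>Least\<close> denotes the minimum only when it is attained; it is, since the feasible set is
  nonempty and compact.\<close>

definition eta :: "nat \<Rightarrow> nat \<Rightarrow> nat \<Rightarrow> nat \<Rightarrow> ('k::finite \<Rightarrow> real ^ 'p \<Rightarrow> real)
    \<Rightarrow> ('k \<Rightarrow> complex mat) \<Rightarrow> (nat \<Rightarrow> real ^ 'p) \<Rightarrow> (nat \<Rightarrow> nat \<Rightarrow> complex vec)
    \<Rightarrow> complex mat \<Rightarrow> (real ^ 'p \<Rightarrow> nat \<Rightarrow> complex vec) \<Rightarrow> real ^ 'p \<Rightarrow> real" where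
  "eta n l r j \<theta> A pts v V w \<mu> =
     (LEAST t. \<exists>y\<in>Y_LB n l r j \<theta> A pts v V w \<mu>. t = inner (theta_vec \<theta> \<mu>) y)"

end

theory Submission
  imports Defs
begin

text \<open>
  With \<open>P = V\<^sup>* U U\<^sup>* V\<close> and \<open>R\<^sup>2 = \<lambda>\<^bsub>l+1\<^esub> - \<Lambda>\<close>, the matrix \<open>\<Lambda> - \<lambda>\<^sub>1 - P (\<Lambda> - \<lambda>\<^bsub>l+1\<^esub>)\<close> defining the gap
  has the same spectrum as the Hermitian matrix \<open>\<Lambda> - \<lambda>\<^sub>1 + R P R\<close>, which is positive semidefinite. So
  the gap is a minimal Rayleigh quotient. If \<open>\<lambda>\<^sub>q < \<lambda>\<^bsub>q+1\<^esub>\<close> for some \<open>q \<le> r\<close> at an interpolation point,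
  the first \<open>q\<close> Ritz vectors there span the eigenspaces of \<open>\<lambda>\<^sub>1, \<dots>, \<lambda>\<^sub>q\<close>, because the compression to
  \<open>V\<^sub>j\<close> has the same lowest \<open>l\<close> eigenvalues; hence the gap is at least \<open>\<lambda>\<^bsub>q+1\<^esub> - \<lambda>\<^sub>1\<close>, with equality
  for \<open>q = r\<close>. Simplicity of \<open>\<lambda>\<^sub>1\<close> is the case \<open>q = 1\<close>.

  The bounds on \<open>eta\<close> are the constraints defining \<open>Y_LB\<close> at the interpolation point itself. Since
  \<open>eta\<close> is a \<open>Least\<close>, this needs a feasible point: the Rayleigh quotients \<open>u\<^sup>* A\<^sub>m u\<close> of a unit
  vector \<open>u\<close> orthogonal to the \<open>r < n\<close> columns of \<open>U\<close> form one.
\<close>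

section \<open>The Hermitian inner product and adjoints\<close>

text \<open>The real number behind \<open>x \<bullet>c x\<close>, which has type complex; kept real
  so that it can be compared. Squared lengths are what Rayleigh quotients and projections
  involve.\<close>

definition vec_sqnorm :: "complex vec \<Rightarrow> real" where
  "vec_sqnorm x = (\<Sum>i<dim_vec x. (cmod (x $ i))\<^sup>2)"

lemma cscalar_prod_sum: "dim_vec x = n \<Longrightarrow> dim_vec y = n \<Longrightarrow> x \<bullet>c y = (\<Sum>i<n. x $ i * cnj (y $ i))"
  by (simp add: scalar_prod_def conjugate_complex_def lessThan_atLeast0)

lemma cscalar_prod_self: "x \<bullet>c x = complex_of_real (vec_sqnorm x)"
  by (simp add: cscalar_prod_sum[OF refl refl] vec_sqnorm_def complex_norm_square flip: of_real_power)

lemma vec_sqnorm_nonneg [simp]: "0 \<le> vec_sqnorm x"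
  by (simp add: vec_sqnorm_def sum_nonneg)

lemma vec_sqnorm_eq_0_iff: "x \<in> carrier_vec n \<Longrightarrow> vec_sqnorm x = 0 \<longleftrightarrow> x = 0\<^sub>v n"
  using cscalar_prod_self[of x] conjugate_square_eq_0_vec[of x n] by auto

lemma vec_sqnorm_smult: "vec_sqnorm (c \<cdot>\<^sub>v x) = (cmod c)\<^sup>2 * vec_sqnorm x"
  by (simp add: vec_sqnorm_def norm_mult power_mult_distrib sum_distrib_left)

lemma cscalar_prod_cnj: "dim_vec x = dim_vec y \<Longrightarrow> cnj (x \<bullet>c y) = y \<bullet>c x"
  by (simp add: cscalar_prod_sum[of _ "dim_vec y"] mult.commute)

lemma cscalar_prod_zero_comm:
  fixes x y :: "complex vec"
  shows "dim_vec x = dim_vec y \<Longrightarrow> x \<bullet>c y = 0 \<longleftrightarrow> y \<bullet>c x = 0"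
  using cscalar_prod_cnj[of x y] by (metis complex_cnj_zero_iff)

lemma cscalar_prod_smult_right:
  fixes x y :: "complex vec"
  shows "dim_vec x = dim_vec y \<Longrightarrow> x \<bullet>c (c \<cdot>\<^sub>v y) = cnj c * (x \<bullet>c y)"
  by (simp add: cscalar_prod_sum[of _ "dim_vec y"] sum_distrib_left mult_ac)

lemma dim_mat_adjoint [simp]: "dim_row (mat_adjoint M) = dim_col M" "dim_col (mat_adjoint M) = dim_row M"
  by (simp_all add: mat_adjoint_def)

lemma mat_adjoint_carrier [simp]: "M \<in> carrier_mat m n \<Longrightarrow> mat_adjoint M \<in> carrier_mat n m"
  by (auto intro: carrier_matI)

lemma index_mat_adjoint [simp]:
  "i < dim_col M \<Longrightarrow> k < dim_row M \<Longrightarrow> mat_adjoint M $$ (i, k) = cnj (M $$ (k, i))"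
  by (simp add: mat_adjoint_def mat_of_rows_index conjugate_complex_def)

lemma mat_adjoint_mult:
  fixes M N :: "complex mat"
  assumes "M \<in> carrier_mat m n" "N \<in> carrier_mat n q"
  shows "mat_adjoint (M * N) = mat_adjoint N * mat_adjoint M"
  using assms by (intro eq_matI) (auto simp: scalar_prod_def mult.commute)

lemma mat_adjoint_adjoint [simp]: "mat_adjoint (mat_adjoint M) = (M :: complex mat)"
  by (intro eq_matI) auto

lemma mult_mat_vec_sum:
  "i < dim_row M \<Longrightarrow> dim_vec x = dim_col M \<Longrightarrow> (M *\<^sub>v x) $ i = (\<Sum>k<dim_col M. M $$ (i, k) * x $ k)"
  by (simp add: scalar_prod_def lessThan_atLeast0)

lemma cscalar_prod_adjoint:
  fixes M :: "complex mat"
  assumes "M \<in> carrier_mat m n" "x \<in> carrier_vec n" "y \<in> carrier_vec m"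
  shows "(M *\<^sub>v x) \<bullet>c y = x \<bullet>c (mat_adjoint M *\<^sub>v y)"
proof -
  have "(M *\<^sub>v x) \<bullet>c y = (\<Sum>i<m. \<Sum>k<n. M $$ (i, k) * x $ k * cnj (y $ i))"
    using assms by (simp add: cscalar_prod_sum[of _ m] mult_mat_vec_sum sum_distrib_right
        del: index_mult_mat_vec)
  also have "\<dots> = (\<Sum>k<n. \<Sum>i<m. M $$ (i, k) * x $ k * cnj (y $ i))"
    by (rule sum.swap)
  also have "\<dots> = x \<bullet>c (mat_adjoint M *\<^sub>v y)"
    using assms by (simp add: cscalar_prod_sum[of _ n] mult_mat_vec_sum sum_distrib_left mult_ac
        del: index_mult_mat_vec)
  finally show ?thesis .
qed

lemma cscalar_prod_hermitian:
  assumes "M \<in> carrier_mat n n" "hermitian_mat M" "x \<in> carrier_vec n" "y \<in> carrier_vec n"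
  shows "(M *\<^sub>v x) \<bullet>c y = x \<bullet>c (M *\<^sub>v y)"
  using cscalar_prod_adjoint[OF assms(1,3,4)] assms(2) by (simp add: hermitian_mat_def)

lemma hermitian_conjugation:
  assumes "M \<in> carrier_mat n n" "hermitian_mat M" "B \<in> carrier_mat n d"
  shows "hermitian_mat (mat_adjoint B * M * B)"
proof -
  have 1: "mat_adjoint B * M \<in> carrier_mat d n" using assms by auto
  show ?thesis
    using assms unfolding hermitian_mat_def mat_adjoint_mult[OF 1 assms(3)]
    by (simp add: mat_adjoint_mult[of _ d n _ n] assoc_mult_mat[of _ d n _ n _ d])
qed

lemma smult_mat_mult_vec:
  assumes "M \<in> carrier_mat m n" "x \<in> carrier_vec n"
  shows "(c \<cdot>\<^sub>m M) *\<^sub>v x = c \<cdot>\<^sub>v (M *\<^sub>v x)"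
  using assms by (intro eq_vecI) (auto simp: scalar_prod_def sum_distrib_left mult_ac)

section \<open>Orthonormal systems\<close>

lemma orthonormal_onD:
  assumes "orthonormal_on n q v" "k \<in> {1..q}"
  shows "v k \<in> carrier_vec n" "dim_vec (v k) = n" "v k \<bullet>c v k = 1" "vec_sqnorm (v k) = 1"
  using assms cscalar_prod_self[of "v k"] by (auto simp: orthonormal_on_def)

lemma orthonormal_on_orth:
  "orthonormal_on n q v \<Longrightarrow> a \<in> {1..q} \<Longrightarrow> b \<in> {1..q} \<Longrightarrow> v a \<bullet>c v b = (if a = b then 1 else 0)"
  by (auto simp: orthonormal_on_def)

lemma cols_mat_carrier [simp]: "cols_mat n q v \<in> carrier_mat n q"
  by (simp add: cols_mat_def mat_of_cols_def del: upt_Suc)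

lemma dim_cols_mat [simp]: "dim_row (cols_mat n q v) = n" "dim_col (cols_mat n q v) = q"
  using cols_mat_carrier[of n q v] by blast+

lemma index_cols_mat [simp]: "i < n \<Longrightarrow> k < q \<Longrightarrow> cols_mat n q v $$ (i, k) = v (Suc k) $ i"
  unfolding cols_mat_def by (subst mat_of_cols_index) (simp_all del: upt_Suc)

lemma cols_mat_adjoint_mult_vec:
  assumes "x \<in> carrier_vec n" "\<And>k. k \<in> {1..q} \<Longrightarrow> v k \<in> carrier_vec n"
  shows "mat_adjoint (cols_mat n q v) *\<^sub>v x = vec q (\<lambda>k. x \<bullet>c v (Suc k))"
proof (intro eq_vecI)
  fix k assume k: "k < dim_vec (vec q (\<lambda>k. x \<bullet>c v (Suc k)))"
  then have "dim_vec (v (Suc k)) = n" using assms(2)[of "Suc k"] by auto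
  with k assms(1) show "(mat_adjoint (cols_mat n q v) *\<^sub>v x) $ k = vec q (\<lambda>k. x \<bullet>c v (Suc k)) $ k"
    by (simp add: mult_mat_vec_sum cscalar_prod_sum[of _ n] mult.commute del: index_mult_mat_vec)
qed simp

lemma sum_atLeast1_shift: "(\<Sum>k<q. f (Suc k)) = (\<Sum>k\<in>{1..q}. f k)"
  using sum.shift_bounds_Suc_ivl[of f 0 q] by (simp add: lessThan_atLeast0 atLeastLessThanSuc_atLeastAtMost)

lemma orthonormal_on_adjoint:
  assumes "orthonormal_on n q v"
  shows "mat_adjoint (cols_mat n q v) * cols_mat n q v = 1\<^sub>m q"
proof (intro eq_matI)
  fix a b assume "a < dim_row (1\<^sub>m q)" "b < dim_col (1\<^sub>m q)"
  then have ab: "a < q" "b < q" by auto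
  have "(mat_adjoint (cols_mat n q v) * cols_mat n q v) $$ (a, b) = v (Suc b) \<bullet>c v (Suc a)"
    using ab orthonormal_onD(2)[OF assms, of "Suc a"] orthonormal_onD(2)[OF assms, of "Suc b"]
    by (simp add: scalar_prod_def cscalar_prod_sum[of _ n] mult.commute lessThan_atLeast0)
  then show "(mat_adjoint (cols_mat n q v) * cols_mat n q v) $$ (a, b) = 1\<^sub>m q $$ (a, b)"
    using ab orthonormal_on_orth[OF assms, of "Suc b" "Suc a"] by auto
qed auto

text \<open>The \<open>u k\<close> are the columns of a square matrix \<open>B\<close> with
  \<open>B^* B = 1\<close>. Squareness turns this into \<open>B B^* = 1\<close>, so passing to
  coordinates preserves the inner product.\<close>

lemma parseval:
  assumes "orthonormal_on n n u" "x \<in> carrier_vec n" "y \<in> carrier_vec n"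
  shows "x \<bullet>c y = (\<Sum>k\<in>{1..n}. (x \<bullet>c u k) * cnj (y \<bullet>c u k))"
proof -
  let ?B = "cols_mat n n u"
  have coords: "mat_adjoint ?B *\<^sub>v z = vec n (\<lambda>k. z \<bullet>c u (Suc k))" if "z \<in> carrier_vec n" for z
    using that orthonormal_onD(1)[OF assms(1)] by (rule cols_mat_adjoint_mult_vec)
  have "mat_adjoint ?B * ?B = 1\<^sub>m n" by (rule orthonormal_on_adjoint[OF assms(1)])
  then have B: "?B * mat_adjoint ?B = 1\<^sub>m n"
    by (rule mat_mult_left_right_inverse[rotated 2]) auto
  have y: "?B *\<^sub>v (mat_adjoint ?B *\<^sub>v y) = y"
    using assms(3) B by (simp flip: assoc_mult_mat_vec[of _ n n _ n])
  have "(mat_adjoint ?B *\<^sub>v x) \<bullet>c (mat_adjoint ?B *\<^sub>v y) = x \<bullet>c (?B *\<^sub>v (mat_adjoint ?B *\<^sub>v y))"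
    by (subst cscalar_prod_adjoint[of _ n n]) (use assms in \<open>auto intro!: mult_mat_vec_carrier\<close>)
  also have "\<dots> = x \<bullet>c y" by (simp only: y)
  finally have "x \<bullet>c y = (mat_adjoint ?B *\<^sub>v x) \<bullet>c (mat_adjoint ?B *\<^sub>v y)" ..
  also have "\<dots> = (\<Sum>k<n. (x \<bullet>c u (Suc k)) * cnj (y \<bullet>c u (Suc k)))"
    unfolding coords[OF assms(2)] coords[OF assms(3)] by (subst cscalar_prod_sum[of _ n]) simp_all
  also have "\<dots> = (\<Sum>k\<in>{1..n}. (x \<bullet>c u k) * cnj (y \<bullet>c u k))" by (rule sum_atLeast1_shift)
  finally show ?thesis .
qed

lemma parseval_sqnorm:
  assumes "orthonormal_on n n u" "x \<in> carrier_vec n"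
  shows "vec_sqnorm x = (\<Sum>k\<in>{1..n}. (cmod (x \<bullet>c u k))\<^sup>2)"
proof -
  have "complex_of_real (vec_sqnorm x) = complex_of_real (\<Sum>k\<in>{1..n}. (cmod (x \<bullet>c u k))\<^sup>2)"
    unfolding cscalar_prod_self[symmetric] parseval[OF assms(1,2,2)]
    by (simp add: complex_norm_square flip: of_real_power)
  then show ?thesis by (simp only: of_real_eq_iff)
qed

text \<open>The \<open>q\<close> orthogonality conditions, padded with zero rows, form a square
  matrix \<open>M\<close>. As \<open>q < n\<close>, its last row is zero, so the transpose kills the
  last unit vector and \<open>M\<close> is singular; a kernel vector is then normalised.\<close>

lemma exists_unit_orthogonal:
  assumes "q < n" and v: "\<And>k. k \<in> {1..q} \<Longrightarrow> v k \<in> carrier_vec n"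
  shows "\<exists>x\<in>carrier_vec n. vec_sqnorm x = 1 \<and> (\<forall>k\<in>{1..q}. x \<bullet>c v k = 0)"
proof -
  define M where "M = mat n n (\<lambda>(i, k). if i < q then cnj (v (Suc i) $ k) else 0)"
  have M: "M \<in> carrier_mat n n" by (simp add: M_def)
  have "transpose_mat M *\<^sub>v unit_vec n (n - 1) = 0\<^sub>v n"
    using assms(1) by (intro eq_vecI) (auto simp: M_def)
  moreover have "unit_vec n (n - 1) \<noteq> (0\<^sub>v n :: complex vec)"
    using assms(1) by auto
  ultimately have "det (transpose_mat M) = 0"
    using M by (subst det_0_iff_vec_prod_zero[of _ n]) (auto intro!: exI[of _ "unit_vec n (n - 1)"])
  then have "det M = 0" using det_transpose[OF M] by simp
  then obtain x where x: "x \<in> carrier_vec n" "x \<noteq> 0\<^sub>v n" "M *\<^sub>v x = 0\<^sub>v n"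
    using det_0_iff_vec_prod_zero[OF M] by auto
  have orth: "x \<bullet>c v k = 0" if k: "k \<in> {1..q}" for k
  proof -
    have "(M *\<^sub>v x) $ (k - 1) = (\<Sum>i<n. M $$ (k - 1, i) * x $ i)"
      using k M x(1) assms(1) by (subst mult_mat_vec_sum) auto
    also have "\<dots> = x \<bullet>c v k"
      using k x(1) v[OF k] assms(1) by (auto simp: M_def cscalar_prod_sum[of _ n] mult.commute intro!: sum.cong)
    finally have "x \<bullet>c v k = (M *\<^sub>v x) $ (k - 1)" ..
    moreover have "k - 1 < n" using k assms(1) by auto
    ultimately show ?thesis using x(3) by simp
  qed
  have pos: "vec_sqnorm x > 0"
    using x vec_sqnorm_eq_0_iff[OF x(1)] vec_sqnorm_nonneg[of x] by linarith
  define y where "y = complex_of_real (1 / sqrt (vec_sqnorm x)) \<cdot>\<^sub>v x"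
  have "vec_sqnorm y = 1"
    using pos by (simp add: y_def vec_sqnorm_smult norm_divide power_divide)
  moreover have "y \<bullet>c v k = 0" if "k \<in> {1..q}" for k
    using orth[OF that] x(1) v[OF that] by (simp add: y_def)
  ultimately show ?thesis using x(1) by (intro bexI[of _ y]) (auto simp: y_def)
qed

lemma orthonormal_on_snoc:
  assumes v: "orthonormal_on n q v" and x: "x \<in> carrier_vec n" "vec_sqnorm x = 1"
    and orth: "\<And>k. k \<in> {1..q} \<Longrightarrow> x \<bullet>c v k = 0"
  shows "orthonormal_on n (Suc q) (v(Suc q := x))"
proof -
  have "v k \<bullet>c x = 0" if "k \<in> {1..q}" for k
    using orth[OF that] cscalar_prod_zero_comm[of x "v k"] x(1) orthonormal_onD(2)[OF v that] by auto
  moreover have "x \<bullet>c x = 1" by (simp add: cscalar_prod_self x(2))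
  ultimately show ?thesis
    using assms by (auto simp: orthonormal_on_def le_Suc_eq)
qed

lemma orthonormal_on_mono: "orthonormal_on n q v \<Longrightarrow> p \<le> q \<Longrightarrow> orthonormal_on n p v"
  by (auto simp: orthonormal_on_def)

text \<open>Downward induction on \<open>q\<close> from the full system \<open>q = n\<close>: below
  \<open>n\<close> there is always a unit vector orthogonal to those present, which becomes vector
  \<open>Suc q\<close>.\<close>

lemma orthonormal_on_extend:
  assumes "q \<le> n" "orthonormal_on n q v"
  shows "\<exists>u. orthonormal_on n n u \<and> (\<forall>k\<in>{1..q}. u k = v k)"
  using assms
proof (induction q arbitrary: v rule: inc_induct)
  case base
  then show ?case by blast
next
  case (step q)
  obtain x where "x \<in> carrier_vec n" "vec_sqnorm x = 1" "\<forall>k\<in>{1..q}. x \<bullet>c v k = 0"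
    using exists_unit_orthogonal[of q n v] orthonormal_onD(1)[OF step.prems] step.hyps by blast
  then have "orthonormal_on n (Suc q) (v(Suc q := x))"
    using orthonormal_on_snoc[OF step.prems] by blast
  from step.IH[OF this] obtain u
    where "orthonormal_on n n u" "\<forall>k\<in>{1..Suc q}. u k = (v(Suc q := x)) k" by blast
  then show ?case by (intro exI[of _ u]) auto
qed

text \<open>Otherwise the first \<open>n\<close> vectors would already be a basis, and Parseval
  would force the next one to have norm zero.\<close>

lemma orthonormal_on_le_dim:
  assumes "orthonormal_on n q v"
  shows "q \<le> n"
proof (rule ccontr)
  assume "\<not> q \<le> n"
  then have q: "Suc n \<le> q" by simp
  have n: "orthonormal_on n n v" using orthonormal_on_mono[OF assms, of n] q by simp
  have "vec_sqnorm (v (Suc n)) = (\<Sum>k\<in>{1..n}. (cmod (v (Suc n) \<bullet>c v k))\<^sup>2)"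
    by (rule parseval_sqnorm[OF n orthonormal_onD(1)[OF assms]]) (use q in auto)
  also have "\<dots> = 0" using q orthonormal_on_orth[OF assms, of "Suc n"] by (intro sum.neutral) auto
  finally show False using orthonormal_onD(4)[OF assms, of "Suc n"] q by simp
qed

text \<open>Complete the system to a basis and drop terms from Parseval's identity.\<close>

lemma bessel:
  assumes v: "orthonormal_on n q v" and x: "x \<in> carrier_vec n"
  shows "(\<Sum>k\<in>{1..q}. (cmod (x \<bullet>c v k))\<^sup>2) \<le> vec_sqnorm x"
proof -
  have q: "q \<le> n" by (rule orthonormal_on_le_dim[OF v])
  from orthonormal_on_extend[OF q v] obtain u
    where u: "orthonormal_on n n u" "\<forall>k\<in>{1..q}. u k = v k" by blast
  have "(\<Sum>k\<in>{1..q}. (cmod (x \<bullet>c v k))\<^sup>2) = (\<Sum>k\<in>{1..q}. (cmod (x \<bullet>c u k))\<^sup>2)"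
    using u by (intro sum.cong) auto
  also have "\<dots> \<le> (\<Sum>k\<in>{1..n}. (cmod (x \<bullet>c u k))\<^sup>2)"
    using q by (intro sum_mono2) auto
  finally show ?thesis by (simp add: parseval_sqnorm[OF u(1) x])
qed

section \<open>Eigenbases of Hermitian matrices\<close>

text \<open>The whole list that \<open>eig\<close> indexes, so that length, order and multiplicities
  can be treated at once.\<close>

definition eigs_list :: "complex mat \<Rightarrow> real list" where
  "eigs_list M = sorted_list_of_multiset (image_mset Re (proots (char_poly M)))"

lemma eig_eigs_list: "eig M k = eigs_list M ! (k - 1)"
  by (simp add: eig_def eigs_list_def)

lemma length_eigs_list:
  assumes "M \<in> carrier_mat n n"
  shows "length (eigs_list M) = n"
proof -
  have "length (eigs_list M) = size (mset (eigs_list M))" by simp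
  also have "\<dots> = n"
    using degree_monic_char_poly[OF assms]
    by (simp only: eigs_list_def mset_sorted_list_of_multiset size_image_mset size_proots_complex)
  finally show ?thesis .
qed

lemma eig_mono:
  assumes "M \<in> carrier_mat n n" "1 \<le> a" "a \<le> b" "b \<le> n"
  shows "eig M a \<le> eig M b"
  unfolding eig_eigs_list
  by (rule sorted_nth_mono) (use assms length_eigs_list[OF assms(1)] in \<open>auto simp: eigs_list_def\<close>)

text \<open>The eigenvalues \<open>f\<close> come in no prescribed order: such bases arise by
  extending a given partial system, and only later is \<open>f\<close> compared with the sorted
  list.\<close>

definition eigenbasis :: "complex mat \<Rightarrow> nat \<Rightarrow> (nat \<Rightarrow> complex vec) \<Rightarrow> (nat \<Rightarrow> real) \<Rightarrow> bool" where
  "eigenbasis M n u f \<longleftrightarrow> M \<in> carrier_mat n n \<and> orthonormal_on n n u \<and>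
     (\<forall>k\<in>{1..n}. M *\<^sub>v u k = complex_of_real (f k) \<cdot>\<^sub>v u k)"

text \<open>With the eigenvectors as columns of a unitary \<open>B\<close>, \<open>M B = B D\<close>
  for diagonal \<open>D\<close>, so \<open>M\<close> is similar to \<open>D\<close>.\<close>

lemma char_poly_eigenbasis:
  assumes "eigenbasis M n u f"
  shows "char_poly M = (\<Prod>a\<leftarrow>map (complex_of_real \<circ> f) [1..<Suc n]. [:- a, 1:])"
proof -
  have M: "M \<in> carrier_mat n n" and u: "orthonormal_on n n u"
    and ev: "\<And>k. k \<in> {1..n} \<Longrightarrow> M *\<^sub>v u k = complex_of_real (f k) \<cdot>\<^sub>v u k"
    using assms by (auto simp: eigenbasis_def)
  define B where "B = cols_mat n n u"
  define D where "D = mat_diag n (\<lambda>k. complex_of_real (f (Suc k)))"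
  have B: "B \<in> carrier_mat n n" and D: "D \<in> carrier_mat n n" by (simp_all add: B_def D_def)
  have adj: "mat_adjoint B * B = 1\<^sub>m n"
    unfolding B_def by (rule orthonormal_on_adjoint[OF u])
  then have adj': "B * mat_adjoint B = 1\<^sub>m n"
    by (rule mat_mult_left_right_inverse[rotated 2]) (use B in auto)
  have "M * B = B * D"
  proof (intro eq_matI)
    fix i k assume "i < dim_row (B * D)" "k < dim_col (B * D)"
    then have ik: "i < n" "k < n" using B D by auto
    have k: "Suc k \<in> {1..n}" using ik by auto
    have "Matrix.col B k = u (Suc k)"
      using ik orthonormal_onD(2)[OF u k] by (intro eq_vecI) (auto simp: B_def)
    then have "(M * B) $$ (i, k) = (M *\<^sub>v u (Suc k)) $ i"
      using ik M B by simp
    also have "\<dots> = B $$ (i, k) * complex_of_real (f (Suc k))"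
      unfolding ev[OF k] using ik orthonormal_onD(2)[OF u k] by (simp add: B_def)
    also have "\<dots> = (B * D) $$ (i, k)"
      using ik B unfolding D_def by (subst mat_diag_mult_right[of _ n n]) auto
    finally show "(M * B) $$ (i, k) = (B * D) $$ (i, k)" .
  qed (use M B D in auto)
  have "M = M * (B * mat_adjoint B)" using M by (simp add: adj')
  also have "\<dots> = B * D * mat_adjoint B"
    using M B D \<open>M * B = B * D\<close> assoc_mult_mat[OF M B, of "mat_adjoint B" n] by auto
  finally have "similar_mat_wit M D B (mat_adjoint B)"
    using M B D adj adj' unfolding similar_mat_wit_def Let_def by auto
  then have "char_poly M = char_poly D"
    by (intro char_poly_similar) (auto simp: similar_mat_def)
  also have "\<dots> = (\<Prod>a\<leftarrow>diag_mat D. [:- a, 1:])"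
    by (rule char_poly_upper_triangular[OF D]) (auto simp: upper_triangular_def D_def mat_diag_def)
  also have "diag_mat D = map (complex_of_real \<circ> f) [1..<Suc n]"
    by (intro nth_equalityI) (auto simp: diag_mat_def D_def mat_diag_def simp del: upt_Suc)
  finally show ?thesis .
qed

lemma proots_prod_list_linear: "proots (\<Prod>a\<leftarrow>xs. [:- a, 1:]) = mset (xs :: 'a :: idom list)"
proof (induction xs)
  case (Cons a xs)
  have "(\<Prod>a\<leftarrow>xs. [:- a, 1:]) \<noteq> 0" by (auto simp: prod_list_zero_iff)
  then have "proots ([:- a, 1:] * (\<Prod>a\<leftarrow>xs. [:- a, 1:])) = proots [:- a, 1:] + mset xs"
    by (subst proots_mult) (use Cons in auto)
  then show ?case by (simp only: list.map prod_list.Cons proots_linear_factor) simp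
qed simp

lemma eigs_list_eigenbasis:
  assumes "eigenbasis M n u f"
  shows "eigs_list M = sort (map f [1..<Suc n])"
  unfolding eigs_list_def char_poly_eigenbasis[OF assms] proots_prod_list_linear
  by (simp flip: sorted_list_of_multiset_mset del: upt_Suc add: multiset.map_comp comp_def)

text \<open>Sorting leaves the first \<open>q\<close> values where they are, because they increase
  and are bounded by all later ones; the later ones may be in any order.\<close>

lemma eigenbasis_le_eig:
  assumes "eigenbasis M n u f" "q \<le> n" "k \<in> {1..q}"
    and sorted: "\<And>a b. a \<in> {1..q} \<Longrightarrow> a \<le> b \<Longrightarrow> b \<le> n \<Longrightarrow> f a \<le> f b"
  shows "eig M k = f k"
proof -
  have "eigs_list M = map f [1..<Suc q] @ sort (map f [Suc q..<Suc n])"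
    unfolding eigs_list_eigenbasis[OF assms(1)]
  proof (rule properties_for_sort)
    have "[1..<Suc n] = [1..<Suc q] @ [Suc q..<Suc n]"
      using assms(2) upt_add_eq_append[of 1 "Suc q" "n - q"] by (simp del: upt_Suc)
    then show "mset (map f [1..<Suc q] @ sort (map f [Suc q..<Suc n])) = mset (map f [1..<Suc n])"
      by (simp del: upt_Suc)
    have "sorted (map f [1..<Suc q])"
      unfolding sorted_map sorted_wrt_iff_nth_less using sorted assms(2) by (auto simp del: upt_Suc)
    then show "sorted (map f [1..<Suc q] @ sort (map f [Suc q..<Suc n]))"
      using sorted by (auto simp: sorted_append simp del: upt_Suc)
  qed
  then show ?thesis
    using assms(3) by (auto simp: eig_eigs_list nth_append simp del: upt_Suc)
qed

text \<open>Both lists have the same multiset. Cancelling the \<open>q\<close> lowest eigenvalues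
  from it leaves the later \<open>f k\<close> as a rearrangement of the later eigenvalues, the least
  of which is number \<open>Suc q\<close>. Multisets are essential, as eigenvalues may repeat across
  the cut.\<close>

lemma eig_le_eigenbasis:
  assumes "eigenbasis M n u f" "\<And>k. k \<in> {1..q} \<Longrightarrow> f k = eig M k" "q < k" "k \<le> n"
  shows "eig M (Suc q) \<le> f k"
proof -
  have M: "M \<in> carrier_mat n n" using assms(1) by (simp add: eigenbasis_def)
  have len: "length (eigs_list M) = n" by (rule length_eigs_list[OF M])
  have "map f [1..<Suc q] = take q (eigs_list M)"
    using assms(2-4) len by (intro nth_equalityI) (auto simp: eig_eigs_list simp del: upt_Suc)
  moreover have "[1..<Suc n] = [1..<Suc q] @ [Suc q..<Suc n]"
    using assms(3,4) upt_add_eq_append[of 1 "Suc q" "n - q"] by (simp del: upt_Suc)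
  moreover have "mset (eigs_list M) = mset (map f [1..<Suc n])"
    by (simp only: eigs_list_eigenbasis[OF assms(1)] mset_sort)
  ultimately have "mset (take q (eigs_list M)) + mset (drop q (eigs_list M))
      = mset (take q (eigs_list M)) + mset (map f [Suc q..<Suc n])"
    by (metis append_take_drop_id map_append mset_append)
  then have "mset (drop q (eigs_list M)) = mset (map f [Suc q..<Suc n])" by simp
  then have "set (drop q (eigs_list M)) = set (map f [Suc q..<Suc n])" by (rule mset_eq_setD)
  then have "f k \<in> set (drop q (eigs_list M))" using assms(3,4) by (auto simp del: upt_Suc)
  then obtain i where "i < n - q" "f k = eig M (Suc (q + i))"
    using len by (auto simp: in_set_conv_nth eig_eigs_list)
  then show ?thesis using eig_mono[OF M, of "Suc q" "Suc (q + i)"] assms(3,4) by auto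
qed

section \<open>Eigenvectors of Hermitian matrices and the spectral theorem\<close>

lemma cscalar_prod_mult_eigenvector:
  assumes "M \<in> carrier_mat n n" "hermitian_mat M" "x \<in> carrier_vec n" "y \<in> carrier_vec n"
    "M *\<^sub>v y = complex_of_real c \<cdot>\<^sub>v y"
  shows "(M *\<^sub>v x) \<bullet>c y = complex_of_real c * (x \<bullet>c y)"
  using cscalar_prod_hermitian[OF assms(1-4)] assms(3-5) by (simp add: cscalar_prod_smult_right)

lemma hermitian_eigenvectors_orthogonal:
  assumes "M \<in> carrier_mat n n" "hermitian_mat M" "x \<in> carrier_vec n" "y \<in> carrier_vec n"
    "M *\<^sub>v x = complex_of_real b \<cdot>\<^sub>v x" "M *\<^sub>v y = complex_of_real c \<cdot>\<^sub>v y" "b \<noteq> c"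
  shows "x \<bullet>c y = 0"
  using cscalar_prod_mult_eigenvector[OF assms(1-4,6)] assms(3-7) by simp

text \<open>Parseval for \<open>M *\<^sub>v x\<close> and \<open>x\<close>; self-adjointness moves
  \<open>M\<close> onto the basis vector, which contributes the factor \<open>f k\<close>.\<close>

lemma rayleigh_eigenbasis:
  assumes "eigenbasis M n u f" "hermitian_mat M" "x \<in> carrier_vec n"
  shows "(M *\<^sub>v x) \<bullet>c x = complex_of_real (\<Sum>k\<in>{1..n}. f k * (cmod (x \<bullet>c u k))\<^sup>2)"
proof -
  have M: "M \<in> carrier_mat n n" and u: "orthonormal_on n n u"
    and ev: "\<And>k. k \<in> {1..n} \<Longrightarrow> M *\<^sub>v u k = complex_of_real (f k) \<cdot>\<^sub>v u k"
    using assms by (auto simp: eigenbasis_def)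
  have "(M *\<^sub>v x) \<bullet>c x = (\<Sum>k\<in>{1..n}. ((M *\<^sub>v x) \<bullet>c u k) * cnj (x \<bullet>c u k))"
    by (rule parseval[OF u]) (use M assms(3) in auto)
  also have "\<dots> = (\<Sum>k\<in>{1..n}. complex_of_real (f k * (cmod (x \<bullet>c u k))\<^sup>2))"
  proof (rule sum.cong)
    fix k assume k: "k \<in> {1..n}"
    show "((M *\<^sub>v x) \<bullet>c u k) * cnj (x \<bullet>c u k) = complex_of_real (f k * (cmod (x \<bullet>c u k))\<^sup>2)"
      unfolding cscalar_prod_mult_eigenvector[OF M assms(2,3) orthonormal_onD(1)[OF u k] ev[OF k]]
      by (simp add: complex_norm_square mult.assoc del: of_real_power)
  qed simp
  finally show ?thesis by simp
qed

lemma eigenvectorD: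
  assumes "eigenvector M x z" "M \<in> carrier_mat n n"
  shows "x \<in> carrier_vec n" "x \<noteq> 0\<^sub>v n" "M *\<^sub>v x = z \<cdot>\<^sub>v x" "0 < vec_sqnorm x"
  using assms vec_sqnorm_eq_0_iff[of x n] vec_sqnorm_nonneg[of x]
  by (auto simp: eigenvector_def less_le)

lemma hermitian_eigenvalue_real:
  assumes M: "M \<in> carrier_mat n n" "hermitian_mat M" and x: "eigenvector M x z"
  shows "z = complex_of_real (Re z)"
proof -
  note xD = eigenvectorD[OF x M(1)]
  have "z * (x \<bullet>c x) = (M *\<^sub>v x) \<bullet>c x" using xD(1,3) by simp
  also have "\<dots> = cnj z * (x \<bullet>c x)"
    using cscalar_prod_hermitian[OF M xD(1) xD(1)] xD(1,3) by (simp add: cscalar_prod_smult_right)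
  finally have "z = cnj z" using xD(4) by (simp add: cscalar_prod_self)
  then show ?thesis by (simp add: complex_eq_iff)
qed

lemma compression_mult_vec:
  assumes "M \<in> carrier_mat n n" "B \<in> carrier_mat n d" "y \<in> carrier_vec d"
  shows "(mat_adjoint B * M * B) *\<^sub>v y = mat_adjoint B *\<^sub>v (M *\<^sub>v (B *\<^sub>v y))"
proof -
  have "(mat_adjoint B * M * B) *\<^sub>v y = (mat_adjoint B * M) *\<^sub>v (B *\<^sub>v y)"
    by (rule assoc_mult_mat_vec) (use assms in \<open>auto intro!: mult_carrier_mat[of _ d n]\<close>)
  also have "\<dots> = mat_adjoint B *\<^sub>v (M *\<^sub>v (B *\<^sub>v y))"
    by (rule assoc_mult_mat_vec) (use assms in auto)
  finally show ?thesis .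
qed

text \<open>Compressing to the orthogonal complement of the given eigenvectors, which is invariant.\<close>

lemma exists_eigenvector_orthogonal:
  assumes M: "M \<in> carrier_mat n n" "hermitian_mat M" and v: "orthonormal_on n q v"
    and ev: "\<And>k. k \<in> {1..q} \<Longrightarrow> M *\<^sub>v v k = complex_of_real (f k) \<cdot>\<^sub>v v k" and "q < n"
  shows "\<exists>x c. x \<in> carrier_vec n \<and> vec_sqnorm x = 1 \<and> (\<forall>k\<in>{1..q}. x \<bullet>c v k = 0)
    \<and> M *\<^sub>v x = complex_of_real c \<cdot>\<^sub>v x"
proof -
  have "q \<le> n" using \<open>q < n\<close> by simp
  from orthonormal_on_extend[OF this v] obtain u
    where u: "orthonormal_on n n u" and uv: "\<And>k. k \<in> {1..q} \<Longrightarrow> u k = v k" by blast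
  define m where "m = n - q"
  have m: "0 < m" using \<open>q < n\<close> by (simp add: m_def)
  have w: "orthonormal_on n m (\<lambda>k. u (q + k))"
    using u \<open>q < n\<close> by (auto simp: orthonormal_on_def m_def)
  define B where "B = cols_mat n m (\<lambda>k. u (q + k))"
  have B: "B \<in> carrier_mat n m" by (simp add: B_def)
  have Ba: "mat_adjoint B \<in> carrier_mat m n" using B by simp
  have BB: "mat_adjoint B * B = 1\<^sub>m m" unfolding B_def by (rule orthonormal_on_adjoint[OF w])
  have coords: "mat_adjoint B *\<^sub>v x = vec m (\<lambda>k. x \<bullet>c u (Suc (q + k)))" if "x \<in> carrier_vec n" for x
    using cols_mat_adjoint_mult_vec[OF that orthonormal_onD(1)[OF w]] by (simp add: B_def)
  define C where "C = mat_adjoint B * M * B"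
  have C: "C \<in> carrier_mat m m" using B M by (simp add: C_def mult_carrier_mat[of _ m n])
  obtain z y where y: "eigenvector C y z"
    using spectrum_non_empty[OF C m] by (auto simp: spectrum_def eigenvalue_def)
  note yD = eigenvectorD[OF y C]
  define x where "x = B *\<^sub>v y"
  have x: "x \<in> carrier_vec n" using B yD by (simp add: x_def)
  have Bx: "mat_adjoint B *\<^sub>v x = y"
    using assoc_mult_mat_vec[OF Ba B yD(1)] BB yD(1) by (simp add: x_def)
  have x0: "x \<noteq> 0\<^sub>v n"
  proof
    assume "x = 0\<^sub>v n"
    then have "mat_adjoint B *\<^sub>v x = 0\<^sub>v m" using B by (intro eq_vecI) auto
    with Bx yD(2) show False by simp
  qed
  have orth: "x \<bullet>c v k = 0" if k: "k \<in> {1..q}" for k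
  proof -
    have "mat_adjoint B *\<^sub>v v k = vec m (\<lambda>i. u k \<bullet>c u (Suc (q + i)))"
      using coords[OF orthonormal_onD(1)[OF v k]] uv[OF k] by simp
    also have "\<dots> = 0\<^sub>v m"
      using k \<open>q < n\<close> orthonormal_on_orth[OF u] by (intro eq_vecI) (auto simp: m_def)
    finally have "x \<bullet>c v k = y \<bullet>c 0\<^sub>v m"
      using cscalar_prod_adjoint[OF B yD(1) orthonormal_onD(1)[OF v k]] by (simp add: x_def)
    then show ?thesis using yD(1) by simp
  qed
  \<comment> \<open>The equation \<open>C y = z y\<close> only says that \<open>d\<close> has no
    components along the added basis vectors. Its components along \<open>v\<close> vanish because
    \<open>M *\<^sub>v x\<close> is orthogonal to the eigenvectors \<open>v k\<close>.\<close>
  define d where "d = M *\<^sub>v x - z \<cdot>\<^sub>v x"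
  have Mx: "M *\<^sub>v x \<in> carrier_vec n" using M x by auto
  have d: "d \<in> carrier_vec n" using Mx x by (simp add: d_def)
  have "mat_adjoint B *\<^sub>v (M *\<^sub>v x) = C *\<^sub>v y"
    unfolding C_def x_def by (rule compression_mult_vec[OF M(1) B yD(1), symmetric])
  then have Bd: "mat_adjoint B *\<^sub>v d = 0\<^sub>v m"
    using Bx yD(1,3) x Mx Ba
    by (simp add: d_def mult_minus_distrib_mat_vec[OF Ba Mx] mult_mat_vec[OF Ba x])
  have "d \<bullet>c u k = 0" if k: "k \<in> {1..n}" for k
  proof (cases "k \<le> q")
    case True
    then have kq: "k \<in> {1..q}" using k by simp
    have "(M *\<^sub>v x) \<bullet>c v k = 0"
      using cscalar_prod_mult_eigenvector[OF M x orthonormal_onD(1)[OF v kq] ev[OF kq]] orth[OF kq] by simp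
    then show ?thesis
      using orth[OF kq] orthonormal_onD(1)[OF v kq] x Mx
      by (simp add: uv[OF kq] d_def minus_scalar_prod_distrib[of _ n])
  next
    case False
    then have "(mat_adjoint B *\<^sub>v d) $ (k - Suc q) = d \<bullet>c u k"
      unfolding coords[OF d] using k by (subst index_vec) (auto simp: m_def)
    then show ?thesis using Bd k False by (simp add: m_def)
  qed
  then have "vec_sqnorm d = 0"
    unfolding parseval_sqnorm[OF u d] by (intro sum.neutral) auto
  then have d0: "d = 0\<^sub>v n" using vec_sqnorm_eq_0_iff[OF d] by simp
  have "M *\<^sub>v x = z \<cdot>\<^sub>v x"
  proof (intro eq_vecI)
    fix i assume "i < dim_vec (z \<cdot>\<^sub>v x)"
    then have i: "i < n" using x by simp
    then have "d $ i = (M *\<^sub>v x) $ i - (z \<cdot>\<^sub>v x) $ i" using x Mx M by (simp add: d_def)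
    then show "(M *\<^sub>v x) $ i = (z \<cdot>\<^sub>v x) $ i" using i by (simp add: d0)
  qed (use M x in auto)
  then have xz: "eigenvector M x z" using x x0 M by (simp add: eigenvector_def)
  define c where "c = complex_of_real (1 / sqrt (vec_sqnorm x))"
  have "vec_sqnorm (c \<cdot>\<^sub>v x) = 1"
    using eigenvectorD(4)[OF xz M(1)] by (simp add: c_def vec_sqnorm_smult norm_divide power_divide)
  moreover have "(c \<cdot>\<^sub>v x) \<bullet>c v k = 0" if "k \<in> {1..q}" for k
    using orth[OF that] x orthonormal_onD(1)[OF v that] by simp
  moreover have "M *\<^sub>v (c \<cdot>\<^sub>v x) = complex_of_real (Re z) \<cdot>\<^sub>v (c \<cdot>\<^sub>v x)"
    unfolding hermitian_eigenvalue_real[OF M xz, symmetric] mult_mat_vec[OF M(1) x]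
      eigenvectorD(3)[OF xz M(1)]
    by (simp add: smult_smult_assoc mult.commute)
  ultimately show ?thesis using x by (intro exI[of _ "c \<cdot>\<^sub>v x"] exI[of _ "Re z"]) auto
qed

text \<open>Downward induction again, now adding an eigenvector at each step. The case
  \<open>q = 0\<close> is the spectral theorem; larger \<open>q\<close> keeps prescribed
  eigenvectors in front.\<close>

lemma eigenbasis_extend:
  assumes M: "M \<in> carrier_mat n n" "hermitian_mat M" and "q \<le> n" "orthonormal_on n q v"
    and "\<And>k. k \<in> {1..q} \<Longrightarrow> M *\<^sub>v v k = complex_of_real (f k) \<cdot>\<^sub>v v k"
  shows "\<exists>u g. eigenbasis M n u g \<and> (\<forall>k\<in>{1..q}. u k = v k \<and> g k = f k)"
  using assms(3-)
proof (induction q arbitrary: v f rule: inc_induct)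
  case base
  then show ?case using M by (intro exI[of _ v] exI[of _ f]) (auto simp: eigenbasis_def)
next
  case (step q)
  obtain x c where x: "x \<in> carrier_vec n" "vec_sqnorm x = 1" "\<forall>k\<in>{1..q}. x \<bullet>c v k = 0"
    "M *\<^sub>v x = complex_of_real c \<cdot>\<^sub>v x"
    using exists_eigenvector_orthogonal[OF M step.prems] step.hyps by blast
  have "orthonormal_on n (Suc q) (v(Suc q := x))"
    using orthonormal_on_snoc[OF step.prems(1)] x by blast
  moreover have "M *\<^sub>v (v(Suc q := x)) k = complex_of_real ((f(Suc q := c)) k) \<cdot>\<^sub>v (v(Suc q := x)) k"
    if "k \<in> {1..Suc q}" for k
    using that step.prems(2)[of k] x(4) by auto
  ultimately obtain u g where "eigenbasis M n u g"
    "\<forall>k\<in>{1..Suc q}. u k = (v(Suc q := x)) k \<and> g k = (f(Suc q := c)) k"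
    using step.IH by blast
  then show ?case by (intro exI[of _ u] exI[of _ g]) auto
qed

section \<open>Rayleigh bounds for extreme eigenvalues\<close>

text \<open>The minimum is attained at an eigenvector. For the two bounds, every eigenvalue in an
  eigenbasis lies in the spectrum, so the Rayleigh sum is squeezed between its extremes. The upper
  bound serves the box \<open>B_box\<close>.\<close>

lemma hermitian_lambda_min:
  assumes M: "M \<in> carrier_mat n n" "hermitian_mat M" and "0 < n"
  shows "\<exists>x\<in>carrier_vec n. vec_sqnorm x > 0 \<and> Re ((M *\<^sub>v x) \<bullet>c x) = lambda_min M * vec_sqnorm x"
    and "\<And>x. x \<in> carrier_vec n \<Longrightarrow> lambda_min M * vec_sqnorm x \<le> Re ((M *\<^sub>v x) \<bullet>c x)"
    and "\<And>x. x \<in> carrier_vec n \<Longrightarrow> Re ((M *\<^sub>v x) \<bullet>c x) \<le> lambda_max M * vec_sqnorm x"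
proof -
  have fin: "finite (Re ` spectrum M)" "Re ` spectrum M \<noteq> {}"
    using card_finite_spectrum(1)[OF M(1)] spectrum_non_empty[OF M(1) \<open>0 < n\<close>] by auto
  have "lambda_min M \<in> Re ` spectrum M" unfolding lambda_min_def by (rule Min_in[OF fin])
  then obtain z x where z: "lambda_min M = Re z" and x: "eigenvector M x z"
    by (auto simp: spectrum_def eigenvalue_def)
  note xD = eigenvectorD[OF x M(1)]
  have "(M *\<^sub>v x) \<bullet>c x = complex_of_real (lambda_min M * vec_sqnorm x)"
    using hermitian_eigenvalue_real[OF M x] xD by (simp add: z cscalar_prod_self)
  then show "\<exists>x\<in>carrier_vec n. vec_sqnorm x > 0 \<and> Re ((M *\<^sub>v x) \<bullet>c x) = lambda_min M * vec_sqnorm x"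
    using xD by (intro bexI[of _ x]) auto
  \<comment> \<open>The empty system is extended; the vectors and values passed for
    \<open>q = 0\<close> are placeholders.\<close>
  obtain u f where uf: "eigenbasis M n u f"
    using eigenbasis_extend[OF M, of 0 "\<lambda>_. 0\<^sub>v n" "\<lambda>_. 0"] by (auto simp: orthonormal_on_def)
  have u: "orthonormal_on n n u" using uf by (simp add: eigenbasis_def)
  have "f k \<in> Re ` spectrum M" if k: "k \<in> {1..n}" for k
  proof -
    have "u k \<noteq> 0\<^sub>v n"
      using orthonormal_onD(1,4)[OF u k] vec_sqnorm_eq_0_iff[of "u k" n] by auto
    then have "eigenvector M (u k) (complex_of_real (f k))"
      using uf M orthonormal_onD(1)[OF u k] k by (auto simp: eigenvector_def eigenbasis_def)
    then have "complex_of_real (f k) \<in> spectrum M"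
      by (auto simp: spectrum_def eigenvalue_def)
    then show ?thesis by force
  qed
  then have f: "lambda_min M \<le> f k" "f k \<le> lambda_max M" if "k \<in> {1..n}" for k
    using fin that by (auto simp: lambda_min_def lambda_max_def)
  fix x :: "complex vec" assume x: "x \<in> carrier_vec n"
  have R: "Re ((M *\<^sub>v x) \<bullet>c x) = (\<Sum>k\<in>{1..n}. f k * (cmod (x \<bullet>c u k))\<^sup>2)"
    by (simp add: rayleigh_eigenbasis[OF uf M(2) x])
  show "lambda_min M * vec_sqnorm x \<le> Re ((M *\<^sub>v x) \<bullet>c x)"
    unfolding R parseval_sqnorm[OF u x] sum_distrib_left by (intro sum_mono mult_right_mono f) auto
  show "Re ((M *\<^sub>v x) \<bullet>c x) \<le> lambda_max M * vec_sqnorm x"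
    unfolding R parseval_sqnorm[OF u x] sum_distrib_left by (intro sum_mono mult_right_mono f) auto
qed

section \<open>Matrices with orthonormal columns as isometries\<close>

lemma isometry_cscalar_prod:
  fixes V :: "complex mat"
  assumes "V \<in> carrier_mat n d" "mat_adjoint V * V = 1\<^sub>m d" "x \<in> carrier_vec d" "y \<in> carrier_vec d"
  shows "(V *\<^sub>v x) \<bullet>c (V *\<^sub>v y) = x \<bullet>c y"
proof -
  have "mat_adjoint V *\<^sub>v (V *\<^sub>v y) = y"
    using assoc_mult_mat_vec[of "mat_adjoint V" d n V d y] assms by simp
  moreover have "V *\<^sub>v y \<in> carrier_vec n" using assms by auto
  ultimately show ?thesis using cscalar_prod_adjoint[OF assms(1,3), of "V *\<^sub>v y"] by simp
qed

lemma isometry_sqnorm: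
  fixes V :: "complex mat"
  assumes "V \<in> carrier_mat n d" "mat_adjoint V * V = 1\<^sub>m d" "x \<in> carrier_vec d"
  shows "vec_sqnorm (V *\<^sub>v x) = vec_sqnorm x"
  using isometry_cscalar_prod[OF assms assms(3)] by (simp add: cscalar_prod_self)

lemma isometry_orthonormal_on:
  assumes "V \<in> carrier_mat n d" "mat_adjoint V * V = 1\<^sub>m d" "orthonormal_on d q w"
  shows "orthonormal_on n q (\<lambda>k. V *\<^sub>v w k)"
  using assms by (auto simp: orthonormal_on_def isometry_cscalar_prod)

section \<open>Spectra under reflection by a scalar and under exchanging the factors of a
  product\<close>

lemma hermitian_scalar_minus:
  assumes "Y \<in> carrier_mat n n" "hermitian_mat Y"
  shows "hermitian_mat (complex_of_real c \<cdot>\<^sub>m 1\<^sub>m n - Y)"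
proof -
  have "cnj (Y $$ (k, i)) = Y $$ (i, k)" if "i < n" "k < n" for i k
    using that assms index_mat_adjoint[of i Y k] by (simp add: hermitian_mat_def)
  then show ?thesis unfolding hermitian_mat_def using assms(1) by (intro eq_matI) auto
qed

lemma scalar_minus_mult_vec:
  fixes Y :: "complex mat"
  assumes "Y \<in> carrier_mat n n" "x \<in> carrier_vec n"
  shows "(c \<cdot>\<^sub>m 1\<^sub>m n - Y) *\<^sub>v x = c \<cdot>\<^sub>v x - Y *\<^sub>v x"
  using assms smult_mat_mult_vec[of "1\<^sub>m n" n n x c]
  by (subst minus_mult_distrib_mat_vec[of _ n n]) auto

lemma eigenvalue_scalar_minus:
  fixes Y :: "complex mat"
  assumes Y: "Y \<in> carrier_mat n n" and "eigenvalue Y z"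
  shows "eigenvalue (c \<cdot>\<^sub>m 1\<^sub>m n - Y) (c - z)"
proof -
  from assms obtain x where "eigenvector Y x z" by (auto simp: eigenvalue_def)
  note x = eigenvectorD[OF this Y]
  have "(c \<cdot>\<^sub>m 1\<^sub>m n - Y) *\<^sub>v x = (c - z) \<cdot>\<^sub>v x"
    unfolding scalar_minus_mult_vec[OF Y x(1)] x(3)
    using x(1) by (intro eq_vecI) (auto simp: left_diff_distrib)
  then show ?thesis
    using x Y by (auto simp: eigenvalue_def eigenvector_def intro!: exI[of _ x])
qed

lemma eigenvalue_scalar_minus_iff:
  fixes Y :: "complex mat"
  assumes Y: "Y \<in> carrier_mat n n"
  shows "eigenvalue (c \<cdot>\<^sub>m 1\<^sub>m n - Y) z \<longleftrightarrow> eigenvalue Y (c - z)"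
proof
  have "c \<cdot>\<^sub>m 1\<^sub>m n - (c \<cdot>\<^sub>m 1\<^sub>m n - Y) = Y" using Y by (intro eq_matI) auto
  moreover assume "eigenvalue (c \<cdot>\<^sub>m 1\<^sub>m n - Y) z"
  ultimately show "eigenvalue Y (c - z)"
    using eigenvalue_scalar_minus[of "c \<cdot>\<^sub>m 1\<^sub>m n - Y" n z c] minus_carrier_mat[OF Y] by auto
next
  assume "eigenvalue Y (c - z)"
  then show "eigenvalue (c \<cdot>\<^sub>m 1\<^sub>m n - Y) z"
    using eigenvalue_scalar_minus[OF Y, of "c - z" c] by simp
qed

lemma eigenvalue_0_iff_det:
  fixes Y :: "complex mat"
  assumes "Y \<in> carrier_mat n n"
  shows "eigenvalue Y 0 \<longleftrightarrow> det Y = 0"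
proof -
  have "0 \<cdot>\<^sub>v x = 0\<^sub>v n" if "x \<in> carrier_vec n" for x :: "complex vec"
    using that by (intro eq_vecI) auto
  then show ?thesis
    unfolding det_0_iff_vec_prod_zero[OF assms] eigenvalue_def eigenvector_def using assms by auto
qed

text \<open>For \<open>z \<noteq> 0\<close>, \<open>R\<close> maps an eigenvector \<open>x\<close>
  of \<open>X * R\<close> to one of \<open>R * X\<close>, nonzero because \<open>X\<close> sends it
  to a nonzero multiple of \<open>x\<close>. For \<open>z = 0\<close> the image may vanish, and
  determinants decide instead.\<close>

lemma eigenvalue_mult_commute:
  fixes X R :: "complex mat"
  assumes X: "X \<in> carrier_mat n n" and R: "R \<in> carrier_mat n n" and ev: "eigenvalue (X * R) z"
  shows "eigenvalue (R * X) z"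
proof (cases "z = 0")
  case True
  then show ?thesis
    using ev X R eigenvalue_0_iff_det[of "X * R" n] eigenvalue_0_iff_det[of "R * X" n]
      det_mult[OF X R] det_mult[OF R X] by (auto simp: mult.commute)
next
  case False
  from ev obtain x where "eigenvector (X * R) x z" by (auto simp: eigenvalue_def)
  note x = eigenvectorD[OF this mult_carrier_mat[OF X R]]
  define y where "y = R *\<^sub>v x"
  have y: "y \<in> carrier_vec n" using R x by (simp add: y_def)
  have Xy: "X *\<^sub>v y = z \<cdot>\<^sub>v x" using assoc_mult_mat_vec[OF X R x(1)] x(3) by (simp add: y_def)
  have "(R * X) *\<^sub>v y = z \<cdot>\<^sub>v y"
    using assoc_mult_mat_vec[OF R X y] mult_mat_vec[OF R x(1), of z] unfolding Xy by (simp add: y_def)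
  moreover have "y \<noteq> 0\<^sub>v n"
  proof
    assume "y = 0\<^sub>v n"
    then have "z \<cdot>\<^sub>v x = 0\<^sub>v n" unfolding Xy[symmetric] using X by (intro eq_vecI) auto
    then have "vec_sqnorm (z \<cdot>\<^sub>v x) = 0" using x(1) vec_sqnorm_eq_0_iff[of "z \<cdot>\<^sub>v x" n] by simp
    then show False using x(4) False by (simp add: vec_sqnorm_smult)
  qed
  ultimately show ?thesis
    using y X R by (auto simp: eigenvalue_def eigenvector_def intro!: exI[of _ y])
qed

section \<open>The gap matrix and its quadratic form\<close>

text \<open>Matrix indices start at 0, so entry \<open>a\<close> belongs to eigenvalue
  \<open>a + 1\<close>. The matrix is singular when \<open>eig M l = eig M (l + 1)\<close>, which is
  why spectra are compared through \<open>eigenvalue_mult_commute\<close> and not by conjugation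
  with an inverse.\<close>

definition gap_root :: "nat \<Rightarrow> complex mat \<Rightarrow> complex mat" where
  "gap_root l M = mat_diag l (\<lambda>a. complex_of_real (sqrt (eig M (l + 1) - eig M (a + 1))))"

definition gap_form :: "nat \<Rightarrow> complex mat \<Rightarrow> complex mat \<Rightarrow> complex mat \<Rightarrow> complex vec \<Rightarrow> real" where
  "gap_form l M V U x = (eig M (l + 1) - eig M 1) * vec_sqnorm x - vec_sqnorm (gap_root l M *\<^sub>v x)
     + vec_sqnorm (mat_adjoint U *\<^sub>v (V *\<^sub>v (gap_root l M *\<^sub>v x)))"

lemma gap_root_carrier [simp]: "gap_root l M \<in> carrier_mat l l"
  by (simp add: gap_root_def)

lemma dim_gap_root [simp]: "dim_row (gap_root l M) = l" "dim_col (gap_root l M) = l"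
  using gap_root_carrier[of l M] by blast+

lemma mat_adjoint_gap_root [simp]: "mat_adjoint (gap_root l M) = gap_root l M"
  by (intro eq_matI) (auto simp: gap_root_def mat_diag_def)

lemma gap_root_mult_vec:
  assumes "x \<in> carrier_vec l" "a < l"
  shows "(gap_root l M *\<^sub>v x) $ a = complex_of_real (sqrt (eig M (l + 1) - eig M (a + 1))) * x $ a"
proof -
  have "(gap_root l M *\<^sub>v x) $ a = (\<Sum>k<l. gap_root l M $$ (a, k) * x $ k)"
    using assms by (subst mult_mat_vec_sum) auto
  also have "\<dots> = (\<Sum>k<l. if k = a then gap_root l M $$ (a, a) * x $ a else 0)"
    using assms by (intro sum.cong) (auto simp: gap_root_def mat_diag_def)
  finally show ?thesis using assms by (simp add: gap_root_def mat_diag_def)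
qed

lemma cmod_gap_root_mult_vec:
  assumes "x \<in> carrier_vec l" "a < l" "eig M (a + 1) \<le> eig M (l + 1)"
  shows "(cmod ((gap_root l M *\<^sub>v x) $ a))\<^sup>2 = (eig M (l + 1) - eig M (a + 1)) * (cmod (x $ a))\<^sup>2"
  using gap_root_mult_vec[OF assms(1,2), of M] assms(3) by (simp add: norm_mult power_mult_distrib)

text \<open>The matrix in \<open>beta_gap\<close> is \<open>c - XR\<close> with \<open>R = gap_root\<close>; it has the same spectrum as the
  Hermitian matrix \<open>c - RX\<close>, whose quadratic form is \<open>gap_form\<close>.\<close>

lemma beta_gap_rayleigh:
  assumes l: "1 \<le> l" and V: "V \<in> carrier_mat n l" and U: "U \<in> carrier_mat n r"
    and le: "\<And>k. k \<in> {1..l} \<Longrightarrow> eig M k \<le> eig M (l + 1)"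
  shows "\<And>x. x \<in> carrier_vec l \<Longrightarrow> beta_gap l M V U * vec_sqnorm x \<le> gap_form l M V U x"
    and "\<exists>x\<in>carrier_vec l. 0 < vec_sqnorm x \<and> gap_form l M V U x = beta_gap l M V U * vec_sqnorm x"
proof -
  define R where "R = gap_root l M"
  define W where "W = mat_adjoint U * V"
  define P where "P = mat_adjoint W * W"
  define c where "c = eig M (l + 1) - eig M 1"
  \<comment> \<open>The factor \<open>complex_of_real 1\<close> gives \<open>1 - P\<close> the shape
    to which the lemmas on a scalar minus a matrix apply.\<close>
  define Q where "Q = complex_of_real 1 \<cdot>\<^sub>m 1\<^sub>m l - P"
  define E where "E = mat_diag l (\<lambda>a. complex_of_real (eig M (l + 1) - eig M (a + 1)))"
  define N where "N = complex_of_real c \<cdot>\<^sub>m 1\<^sub>m l - R * (Q * R)"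
  define \<Lambda> where "\<Lambda> = mat_diag l (\<lambda>a. complex_of_real (eig M (a + 1)))"
  define T where "T = \<Lambda> - complex_of_real (eig M 1) \<cdot>\<^sub>m 1\<^sub>m l
    - mat_adjoint V * U * mat_adjoint U * V * (\<Lambda> - complex_of_real (eig M (l + 1)) \<cdot>\<^sub>m 1\<^sub>m l)"
  have R: "R \<in> carrier_mat l l" and W: "W \<in> carrier_mat r l" and P: "P \<in> carrier_mat l l"
    and Q: "Q \<in> carrier_mat l l" and E: "E \<in> carrier_mat l l" and \<Lambda>: "\<Lambda> \<in> carrier_mat l l"
    using U V by (auto simp: R_def W_def P_def Q_def E_def \<Lambda>_def)
  have QR: "Q * R \<in> carrier_mat l l" and RQR: "R * (Q * R) \<in> carrier_mat l l" using Q R by auto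
  have N: "N \<in> carrier_mat l l" unfolding N_def by (rule minus_carrier_mat[OF RQR])
  have adjR: "mat_adjoint R = R" by (simp add: R_def)
  have PVU: "mat_adjoint V * U * mat_adjoint U * V = P"
    unfolding P_def W_def mat_adjoint_mult[OF mat_adjoint_carrier[OF U] V] mat_adjoint_adjoint
    using U V by (intro assoc_mult_mat[of _ l r _ n]) (auto intro!: mult_carrier_mat[of _ l n])
  have RR: "R * R = E"
    using le by (auto simp: R_def gap_root_def E_def mat_diag_def scalar_prod_def
        if_distrib[of "\<lambda>t. t * _"] simp flip: of_real_mult cong: if_cong intro!: eq_matI)
  \<comment> \<open>Since \<open>\<Lambda> - eig M 1 = c - E\<close> with
    \<open>E = eig M (l + 1) - \<Lambda>\<close>, the matrix is
    \<open>c - E + P E = c - Q E\<close>, and \<open>E = R R\<close>.\<close>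
  have T: "T = complex_of_real c \<cdot>\<^sub>m 1\<^sub>m l - (Q * R) * R"
  proof -
    have "\<Lambda> - complex_of_real (eig M (l + 1)) \<cdot>\<^sub>m 1\<^sub>m l
        = mat_diag l (\<lambda>a. complex_of_real (eig M (a + 1) - eig M (l + 1)))"
      by (intro eq_matI) (auto simp: \<Lambda>_def mat_diag_def)
    then have "T = \<Lambda> - complex_of_real (eig M 1) \<cdot>\<^sub>m 1\<^sub>m l
        - mat l l (\<lambda>(i, k). P $$ (i, k) * complex_of_real (eig M (k + 1) - eig M (l + 1)))"
      using mat_diag_mult_right[OF P] by (simp add: T_def PVU)
    moreover have "(Q * R) * R = mat l l (\<lambda>(i, k). Q $$ (i, k) * complex_of_real (eig M (l + 1) - eig M (k + 1)))"
      using mat_diag_mult_right[OF Q] assoc_mult_mat[OF Q R R] by (simp add: RR E_def)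
    ultimately show ?thesis
      using P by (intro eq_matI) (auto simp: \<Lambda>_def mat_diag_def Q_def c_def algebra_simps)
  qed
  have "eigenvalue T z \<longleftrightarrow> eigenvalue N z" for z
    unfolding T N_def using eigenvalue_mult_commute[OF QR R] eigenvalue_mult_commute[OF R QR]
    using eigenvalue_scalar_minus_iff[OF RQR] eigenvalue_scalar_minus_iff[of "Q * R * R" l] QR R
    by (metis mult_carrier_mat)
  then have "spectrum T = spectrum N" by (auto simp: spectrum_def)
  then have beta: "beta_gap l M V U = lambda_min N"
    by (simp add: beta_gap_def lambda_min_def T_def \<Lambda>_def Let_def)
  have herm_P: "hermitian_mat P"
    unfolding hermitian_mat_def P_def using W by (subst mat_adjoint_mult[of _ l r _ l]) auto
  have RQR': "mat_adjoint R * Q * R = R * (Q * R)"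
    using assoc_mult_mat[OF R Q R] by (simp add: adjR)
  have "hermitian_mat Q"
    unfolding Q_def by (rule hermitian_scalar_minus[OF P herm_P])
  then have "hermitian_mat (R * (Q * R))"
    using hermitian_conjugation[OF Q _ R] by (simp only: RQR')
  then have herm_N: "hermitian_mat N"
    unfolding N_def by (rule hermitian_scalar_minus[OF RQR])
  have form: "Re ((N *\<^sub>v x) \<bullet>c x) = gap_form l M V U x" if x: "x \<in> carrier_vec l" for x
  proof -
    define y where "y = R *\<^sub>v x"
    have y: "y \<in> carrier_vec l" using R x by (simp add: y_def)
    have Wy: "W *\<^sub>v y \<in> carrier_vec r" using W y by auto
    have Py: "P *\<^sub>v y = mat_adjoint W *\<^sub>v (W *\<^sub>v y)"
      unfolding P_def using W y by (intro assoc_mult_mat_vec) auto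
    have Qy: "Q *\<^sub>v y = complex_of_real 1 \<cdot>\<^sub>v y - P *\<^sub>v y"
      unfolding Q_def by (rule scalar_minus_mult_vec[OF P y])
    have Qyc: "Q *\<^sub>v y \<in> carrier_vec l" using Q y by auto
    have Pyc: "P *\<^sub>v y \<in> carrier_vec l" using P y by auto
    have "(R * (Q * R)) *\<^sub>v x = R *\<^sub>v (Q *\<^sub>v y)"
      using compression_mult_vec[OF Q R x] unfolding RQR' by (simp only: adjR y_def)
    then have "((R * (Q * R)) *\<^sub>v x) \<bullet>c x = (Q *\<^sub>v y) \<bullet>c y"
      using cscalar_prod_adjoint[OF R Qyc x] by (simp add: adjR y_def)
    also have "\<dots> = y \<bullet>c y - (P *\<^sub>v y) \<bullet>c y"
      unfolding Qy using y Pyc by (subst minus_scalar_prod_distrib[of _ l]) auto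
    also have "(P *\<^sub>v y) \<bullet>c y = (W *\<^sub>v y) \<bullet>c (W *\<^sub>v y)"
      using cscalar_prod_adjoint[OF mat_adjoint_carrier[OF W] Wy y] by (simp add: Py)
    finally have *: "((R * (Q * R)) *\<^sub>v x) \<bullet>c x
      = complex_of_real (vec_sqnorm y - vec_sqnorm (W *\<^sub>v y))"
      by (simp add: cscalar_prod_self)
    have Rx: "(R * (Q * R)) *\<^sub>v x \<in> carrier_vec l" by (rule mult_mat_vec_carrier[OF RQR x])
    have "(N *\<^sub>v x) \<bullet>c x = complex_of_real c * (x \<bullet>c x) - ((R * (Q * R)) *\<^sub>v x) \<bullet>c x"
      unfolding N_def scalar_minus_mult_vec[OF RQR x]
      using x Rx by (subst minus_scalar_prod_distrib[of _ l]) auto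
    moreover have "W *\<^sub>v y = mat_adjoint U *\<^sub>v (V *\<^sub>v y)"
      unfolding W_def using U V y by (intro assoc_mult_mat_vec) auto
    ultimately show ?thesis
      by (simp add: * cscalar_prod_self gap_form_def R_def[symmetric] y_def[symmetric] c_def)
  qed
  show "beta_gap l M V U * vec_sqnorm x \<le> gap_form l M V U x" if "x \<in> carrier_vec l" for x
    using hermitian_lambda_min(2)[OF N herm_N _ that] l form[OF that] by (simp add: beta)
  show "\<exists>x\<in>carrier_vec l. 0 < vec_sqnorm x \<and> gap_form l M V U x = beta_gap l M V U * vec_sqnorm x"
    using hermitian_lambda_min(1)[OF N herm_N] l form by (auto simp: beta)
qed

lemma vec_sqnorm_gap_root:
  assumes "x \<in> carrier_vec l" and "\<And>k. k \<in> {1..l} \<Longrightarrow> eig M k \<le> eig M (l + 1)"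
  shows "vec_sqnorm (gap_root l M *\<^sub>v x)
    = (\<Sum>a<l. (eig M (l + 1) - eig M (a + 1)) * (cmod (x $ a))\<^sup>2)"
  unfolding vec_sqnorm_def using assms
  by (intro sum.cong) (auto simp: cmod_gap_root_mult_vec[unfolded Suc_eq_plus1[symmetric]] simp del: index_mult_mat_vec)

text \<open>In coordinate \<open>a\<close> the term
  \<open>- vec_sqnorm (gap_root l M *\<^sub>v x)\<close> cancels \<open>eig M (l + 1)\<close>,
  leaving \<open>eig M (a + 1) - eig M 1\<close>. This is the form of
  \<open>\<Lambda> - eig M 1 + R P R\<close>, a sum of nonnegative terms.\<close>

lemma gap_form_sum:
  assumes "x \<in> carrier_vec l" and "\<And>k. k \<in> {1..l} \<Longrightarrow> eig M k \<le> eig M (l + 1)"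
  shows "gap_form l M V U x = (\<Sum>a<l. (eig M (a + 1) - eig M 1) * (cmod (x $ a))\<^sup>2)
    + vec_sqnorm (mat_adjoint U *\<^sub>v (V *\<^sub>v (gap_root l M *\<^sub>v x)))"
proof -
  have R: "vec_sqnorm (gap_root l M *\<^sub>v x)
      = (\<Sum>a<l. (eig M (l + 1) - eig M (a + 1)) * (cmod (x $ a))\<^sup>2)"
    by (rule vec_sqnorm_gap_root[OF assms])
  show ?thesis
    unfolding gap_form_def R vec_sqnorm_def[of x]
    using assms(1) by (simp add: sum_distrib_left algebra_simps flip: sum_subtractf)
qed

lemma beta_gap_nonneg:
  assumes "1 \<le> l" "V \<in> carrier_mat n l" "U \<in> carrier_mat n r"
    and "M \<in> carrier_mat n n" "l < n"
  shows "0 \<le> beta_gap l M V U"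
proof -
  have le: "eig M k \<le> eig M (l + 1)" if "k \<in> {1..l}" for k
    using eig_mono[OF assms(4), of k "l + 1"] that assms(5) by auto
  obtain x where x: "x \<in> carrier_vec l" "0 < vec_sqnorm x"
    "gap_form l M V U x = beta_gap l M V U * vec_sqnorm x"
    using beta_gap_rayleigh(2)[OF assms(1-3) le] by blast
  have form: "gap_form l M V U x = (\<Sum>a<l. (eig M (a + 1) - eig M 1) * (cmod (x $ a))\<^sup>2)
    + vec_sqnorm (mat_adjoint U *\<^sub>v (V *\<^sub>v (gap_root l M *\<^sub>v x)))"
    by (rule gap_form_sum[OF x(1) le])
  have "0 \<le> gap_form l M V U x"
    unfolding form using eig_mono[OF assms(4), of 1] assms(5)
    by (intro add_nonneg_nonneg sum_nonneg mult_nonneg_nonneg) auto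
  with x show ?thesis by (simp add: zero_le_mult_iff)
qed

section \<open>Projections onto invariant subspaces\<close>

text \<open>Replacing the first \<open>q\<close> vectors of the basis \<open>t\<close> by
  \<open>w\<close> gives another orthonormal basis with the same tail; Parseval for both bases and
  cancelling the tails leaves the claim.\<close>

lemma orthonormal_on_same_span:
  assumes t: "orthonormal_on d d t" and w: "orthonormal_on d q w"
    and orth: "\<And>m k. m \<in> {1..q} \<Longrightarrow> q < k \<Longrightarrow> k \<le> d \<Longrightarrow> w m \<bullet>c t k = 0"
    and s: "s \<in> carrier_vec d"
  shows "(\<Sum>m\<in>{1..q}. (cmod (s \<bullet>c w m))\<^sup>2) = (\<Sum>k\<in>{1..q}. (cmod (s \<bullet>c t k))\<^sup>2)"
proof -
  have q: "q \<le> d" by (rule orthonormal_on_le_dim[OF w])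
  have orth': "t k \<bullet>c w m = 0" if "m \<in> {1..q}" "q < k" "k \<le> d" for m k
    using orth[OF that] cscalar_prod_zero_comm[of "w m" "t k"] orthonormal_onD(2)[OF w, of m]
      orthonormal_onD(2)[OF t, of k] that by auto
  define u where "u k = (if k \<le> q then w k else t k)" for k
  have u: "orthonormal_on d d u"
    unfolding orthonormal_on_def u_def using t w orth orth' by (auto simp: orthonormal_on_def)
  have split: "(\<Sum>k\<in>{1..d}. f k) = (\<Sum>k\<in>{1..q}. f k) + (\<Sum>k\<in>{q<..d}. f k)" for f :: "nat \<Rightarrow> real"
    using q by (subst sum.union_disjoint[symmetric]) (auto intro!: sum.cong)
  have "(\<Sum>k\<in>{1..q}. (cmod (s \<bullet>c u k))\<^sup>2) + (\<Sum>k\<in>{q<..d}. (cmod (s \<bullet>c u k))\<^sup>2)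
      = (\<Sum>k\<in>{1..q}. (cmod (s \<bullet>c t k))\<^sup>2) + (\<Sum>k\<in>{q<..d}. (cmod (s \<bullet>c t k))\<^sup>2)"
    using parseval_sqnorm[OF u s] parseval_sqnorm[OF t s] unfolding split by simp
  moreover have "(\<Sum>k\<in>{1..q}. (cmod (s \<bullet>c u k))\<^sup>2) = (\<Sum>k\<in>{1..q}. (cmod (s \<bullet>c w k))\<^sup>2)"
    by (intro sum.cong) (auto simp: u_def)
  moreover have "(\<Sum>k\<in>{q<..d}. (cmod (s \<bullet>c u k))\<^sup>2) = (\<Sum>k\<in>{q<..d}. (cmod (s \<bullet>c t k))\<^sup>2)"
    by (intro sum.cong) (auto simp: u_def)
  ultimately show ?thesis by simp
qed

lemma lowest_eigenvectorsD:
  assumes "lowest_eigenvectors M q v" "M \<in> carrier_mat n n"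
  shows "orthonormal_on n q v"
    and "\<And>k. k \<in> {1..q} \<Longrightarrow> M *\<^sub>v v k = complex_of_real (eig M k) \<cdot>\<^sub>v v k"
  using assms by (auto simp: lowest_eigenvectors_def eigenvector_def)

text \<open>Complete \<open>v\<close> to an eigenbasis. The part of \<open>x\<close> outside the
  span of \<open>v\<close> has squared length \<open>vec_sqnorm x\<close> minus the squared
  coordinates, and only meets eigenvalues that are at least \<open>eig M (l + 1)\<close>.\<close>

lemma rayleigh_lowest:
  assumes M: "M \<in> carrier_mat n n" "hermitian_mat M" and v: "lowest_eigenvectors M l v"
    and "l < n" and x: "x \<in> carrier_vec n"
  shows "(\<Sum>k\<in>{1..l}. eig M k * (cmod (x \<bullet>c v k))\<^sup>2)
    + eig M (l + 1) * (vec_sqnorm x - (\<Sum>k\<in>{1..l}. (cmod (x \<bullet>c v k))\<^sup>2)) \<le> Re ((M *\<^sub>v x) \<bullet>c x)"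
proof -
  note vD = lowest_eigenvectorsD[OF v M(1)]
  obtain u f where uf: "eigenbasis M n u f" and uv: "\<forall>k\<in>{1..l}. u k = v k \<and> f k = eig M k"
    using eigenbasis_extend[OF M _ vD] \<open>l < n\<close> by (metis less_imp_le)
  have u: "orthonormal_on n n u" using uf by (simp add: eigenbasis_def)
  have split: "(\<Sum>k\<in>{1..n}. g k) = (\<Sum>k\<in>{1..l}. g k) + (\<Sum>k\<in>{l<..n}. g k)" for g :: "nat \<Rightarrow> real"
    using \<open>l < n\<close> by (subst sum.union_disjoint[symmetric]) (auto intro!: sum.cong)
  have v_u: "(\<Sum>k\<in>{1..l}. g k * (cmod (x \<bullet>c v k))\<^sup>2) = (\<Sum>k\<in>{1..l}. g k * (cmod (x \<bullet>c u k))\<^sup>2)" for g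
    using uv by (intro sum.cong) auto
  have f_eig: "(\<Sum>k\<in>{1..l}. f k * (cmod (x \<bullet>c u k))\<^sup>2) = (\<Sum>k\<in>{1..l}. eig M k * (cmod (x \<bullet>c u k))\<^sup>2)"
    using uv by (intro sum.cong) auto
  have "(\<Sum>k\<in>{l<..n}. eig M (l + 1) * (cmod (x \<bullet>c u k))\<^sup>2) \<le> (\<Sum>k\<in>{l<..n}. f k * (cmod (x \<bullet>c u k))\<^sup>2)"
    using eig_le_eigenbasis[OF uf, of l] uv by (intro sum_mono mult_right_mono) auto
  moreover have "vec_sqnorm x - (\<Sum>k\<in>{1..l}. (cmod (x \<bullet>c v k))\<^sup>2) = (\<Sum>k\<in>{l<..n}. (cmod (x \<bullet>c u k))\<^sup>2)"
    unfolding parseval_sqnorm[OF u x] split using v_u[of "\<lambda>_. 1"] by simp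
  moreover have "Re ((M *\<^sub>v x) \<bullet>c x) = (\<Sum>k\<in>{1..l}. eig M k * (cmod (x \<bullet>c v k))\<^sup>2)
      + (\<Sum>k\<in>{l<..n}. f k * (cmod (x \<bullet>c u k))\<^sup>2)"
    unfolding rayleigh_eigenbasis[OF uf M(2) x] Re_complex_of_real split f_eig v_u ..
  ultimately show ?thesis by (simp add: sum_distrib_left)
qed

text \<open>Within a multiple eigenvalue the Ritz vectors may be rotated, so they need not match the
  \<open>v k\<close> one by one; what agrees is the projection onto the first \<open>q\<close> of
  them, expressed by the squared lengths that enter \<open>gap_form\<close>. The case
  \<open>q = 0\<close> is excluded by the gap, as \<open>eig H 0\<close> and \<open>eig H 1\<close>
  read the same list entry.\<close>

lemma compression_same_span:
  assumes H: "H \<in> carrier_mat n n" "hermitian_mat H" and v: "lowest_eigenvectors H l v"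
    and "l < n" and V: "V \<in> carrier_mat n d" "mat_adjoint V * V = 1\<^sub>m d"
    and range: "\<And>k. k \<in> {1..l} \<Longrightarrow> \<exists>c\<in>carrier_vec d. v k = V *\<^sub>v c"
    and w: "lowest_eigenvectors (mat_adjoint V * H * V) r w"
    and "q \<le> r" "r \<le> l" and gap: "eig H q < eig H (q + 1)"
    and z: "z \<in> carrier_vec n"
  shows "(\<Sum>m\<in>{1..q}. (cmod (z \<bullet>c (V *\<^sub>v w m)))\<^sup>2) = (\<Sum>k\<in>{1..q}. (cmod (z \<bullet>c v k))\<^sup>2)"
proof -
  note vD = lowest_eigenvectorsD[OF v H(1)]
  have Va: "mat_adjoint V \<in> carrier_mat d n" using V by simp
  define G where "G = mat_adjoint V * H * V"
  have G: "G \<in> carrier_mat d d" using H V by (auto simp: G_def intro!: mult_carrier_mat[of _ d n])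
  have herm_G: "hermitian_mat G" unfolding G_def by (rule hermitian_conjugation[OF H V(1)])
  have G_mult: "G *\<^sub>v y = mat_adjoint V *\<^sub>v (H *\<^sub>v (V *\<^sub>v y))" if "y \<in> carrier_vec d" for y
    unfolding G_def by (rule compression_mult_vec[OF H(1) V(1) that])
  note wD = lowest_eigenvectorsD[OF w[folded G_def] G]
  define t where "t k = mat_adjoint V *\<^sub>v v k" for k
  have t: "t k \<in> carrier_vec d" "V *\<^sub>v t k = v k" if k: "k \<in> {1..l}" for k
  proof -
    obtain c where c: "c \<in> carrier_vec d" "v k = V *\<^sub>v c" using range[OF k] by blast
    then have "t k = c" using assoc_mult_mat_vec[OF Va V(1) c(1)] V(2) by (simp add: t_def)
    then show "t k \<in> carrier_vec d" "V *\<^sub>v t k = v k" using c by auto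
  qed
  have t_orth: "orthonormal_on d l t"
    unfolding orthonormal_on_def
  proof (intro conjI ballI)
    fix k k' assume k: "k \<in> {1..l}" "k' \<in> {1..l}"
    show "t k \<bullet>c t k' = (if k = k' then 1 else 0)"
      using isometry_cscalar_prod[OF V t(1)[OF k(1)] t(1)[OF k(2)]] t(2)[OF k(1)] t(2)[OF k(2)]
        orthonormal_on_orth[OF vD(1) k] by simp
  qed (rule t)
  have t_ev: "G *\<^sub>v t k = complex_of_real (eig H k) \<cdot>\<^sub>v t k" if k: "k \<in> {1..l}" for k
    unfolding G_mult[OF t(1)[OF k]] t(2)[OF k] vD(2)[OF k]
    using mult_mat_vec[OF Va orthonormal_onD(1)[OF vD(1) k]] by (simp add: t_def)
  have "l \<le> d" by (rule orthonormal_on_le_dim[OF t_orth])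
  from eigenbasis_extend[OF G herm_G this t_orth t_ev] obtain s g
    where sg: "eigenbasis G d s g" and st: "\<And>k. k \<in> {1..l} \<Longrightarrow> s k = t k"
      and g: "\<And>k. k \<in> {1..l} \<Longrightarrow> g k = eig H k" by blast
  have s: "orthonormal_on d d s" and s_ev: "\<And>k. k \<in> {1..d} \<Longrightarrow> G *\<^sub>v s k = complex_of_real (g k) \<cdot>\<^sub>v s k"
    using sg by (auto simp: eigenbasis_def)
  \<comment> \<open>The lift \<open>V *\<^sub>v s k\<close> is orthogonal to all \<open>v a\<close>,
    so in \<open>rayleigh_lowest\<close> only the term with \<open>eig H (l + 1)\<close>
    survives.\<close>
  have g_ge: "eig H (l + 1) \<le> g k" if k: "l < k" "k \<le> d" for k
  proof -
    have kd: "k \<in> {1..d}" using k by simp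
    note sk = orthonormal_onD[OF s kd]
    have Vs: "V *\<^sub>v s k \<in> carrier_vec n" using V sk by auto
    have HVs: "H *\<^sub>v (V *\<^sub>v s k) \<in> carrier_vec n" using H Vs by auto
    have "(V *\<^sub>v s k) \<bullet>c v a = 0" if a: "a \<in> {1..l}" for a
      using isometry_cscalar_prod[OF V sk(1) t(1)[OF a]] t(2)[OF a] st[OF a]
        orthonormal_on_orth[OF s kd, of a] a k by auto
    then have "eig H (l + 1) * vec_sqnorm (V *\<^sub>v s k) \<le> Re ((H *\<^sub>v (V *\<^sub>v s k)) \<bullet>c (V *\<^sub>v s k))"
      using rayleigh_lowest[OF H v \<open>l < n\<close> Vs] by simp
    also have "(H *\<^sub>v (V *\<^sub>v s k)) \<bullet>c (V *\<^sub>v s k) = (G *\<^sub>v s k) \<bullet>c s k"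
      unfolding G_mult[OF sk(1)] using cscalar_prod_adjoint[OF Va HVs sk(1)] by simp
    also have "\<dots> = complex_of_real (g k)"
      unfolding s_ev[OF kd] using sk by simp
    finally show ?thesis using isometry_sqnorm[OF V sk(1)] sk by simp
  qed
  have eigH: "eig H a \<le> eig H b" if "1 \<le> a" "a \<le> b" "b \<le> l + 1" for a b
    using eig_mono[OF H(1)] that \<open>l < n\<close> by simp
  have eigG: "eig G k = eig H k" if k: "k \<in> {1..l}" for k
  proof -
    \<comment> \<open>Beyond \<open>l\<close> the values \<open>g\<close> are unordered, but all are
      at least \<open>eig H (l + 1)\<close>, which is all that \<open>eigenbasis_le_eig\<close> asks
      for.\<close>
    have "eig G k = g k"
    proof (rule eigenbasis_le_eig[OF sg \<open>l \<le> d\<close> k])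
      fix a b assume ab: "a \<in> {1..l}" "a \<le> b" "b \<le> d"
      show "g a \<le> g b"
      proof (cases "b \<le> l")
        case True
        then show ?thesis using ab g eigH[of a b] by auto
      next
        case False
        then have "eig H a \<le> eig H (l + 1)" "eig H (l + 1) \<le> g b"
          using ab eigH[of a "l + 1"] g_ge[of b] by auto
        then show ?thesis using g[OF ab(1)] by simp
      qed
    qed
    then show ?thesis using g[OF k] by simp
  qed
  have gap_g: "eig H q < g k" if "q < k" "k \<le> d" for k
  proof (cases "k \<le> l")
    case True
    then show ?thesis using gap g[of k] eigH[of "q + 1" k] that by auto
  next
    case False
    then show ?thesis using gap g_ge[of k] eigH[of "q + 1" "l + 1"] that assms(9,10) by auto
  qed
  \<comment> \<open>Here \<open>eig G m = eig H m \<le> eig H q < g k\<close>, so the two vectors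
    belong to different eigenvalues of \<open>G\<close>.\<close>
  have w_orth: "w m \<bullet>c s k = 0" if "m \<in> {1..q}" "q < k" "k \<le> d" for m k
  proof (rule hermitian_eigenvectors_orthogonal[OF G herm_G])
    have m: "m \<in> {1..r}" "m \<in> {1..l}" "k \<in> {1..d}" using that \<open>q \<le> r\<close> \<open>r \<le> l\<close> by auto
    show "w m \<in> carrier_vec d" "s k \<in> carrier_vec d"
      using orthonormal_onD(1)[OF wD(1) m(1)] orthonormal_onD(1)[OF s m(3)] by auto
    show "G *\<^sub>v w m = complex_of_real (eig G m) \<cdot>\<^sub>v w m" by (rule wD(2)[OF m(1)])
    show "G *\<^sub>v s k = complex_of_real (g k) \<cdot>\<^sub>v s k" by (rule s_ev[OF m(3)])
    show "eig G m \<noteq> g k" using gap_g[OF that(2,3)] eigH[of m q] that m eigG[OF m(2)] assms(9,10) by auto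
  qed
  define z' where "z' = mat_adjoint V *\<^sub>v z"
  have z': "z' \<in> carrier_vec d" using Va z by (auto simp: z'_def)
  have zV: "z \<bullet>c (V *\<^sub>v y) = z' \<bullet>c y" if "y \<in> carrier_vec d" for y
    using cscalar_prod_adjoint[OF Va z that] by (simp add: z'_def)
  have "(\<Sum>m\<in>{1..q}. (cmod (z \<bullet>c (V *\<^sub>v w m)))\<^sup>2) = (\<Sum>m\<in>{1..q}. (cmod (z' \<bullet>c w m))\<^sup>2)"
    using orthonormal_onD(1)[OF wD(1)] \<open>q \<le> r\<close> by (intro sum.cong) (auto simp: zV)
  also have "\<dots> = (\<Sum>k\<in>{1..q}. (cmod (z' \<bullet>c s k))\<^sup>2)"
    by (rule orthonormal_on_same_span[OF s orthonormal_on_mono[OF wD(1) \<open>q \<le> r\<close>] w_orth z'])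
  also have "\<dots> = (\<Sum>k\<in>{1..q}. (cmod (z \<bullet>c v k))\<^sup>2)"
  proof (intro sum.cong refl)
    fix k assume "k \<in> {1..q}"
    then have k: "k \<in> {1..l}" using \<open>q \<le> r\<close> \<open>r \<le> l\<close> by auto
    show "(cmod (z' \<bullet>c s k))\<^sup>2 = (cmod (z \<bullet>c v k))\<^sup>2"
      using zV[OF t(1)[OF k]] t(2)[OF k] st[OF k] by simp
  qed
  finally show ?thesis .
qed

text \<open>A vector in the span is a linear combination of the list of columns, that is,
  \<open>V\<close> times a coefficient vector. This supplies the range condition of
  \<open>compression_same_span\<close>.\<close>

lemma orthonormal_basis_mat_range:
  assumes V: "orthonormal_basis_mat n V (vec_span n S)" and S: "S \<subseteq> carrier_vec n" and "x \<in> S"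
  shows "\<exists>c\<in>carrier_vec (dim_col V). x = V *\<^sub>v c"
proof -
  interpret vec_space "TYPE(complex)" n .
  have cols: "set (cols V) \<subseteq> carrier_vec n"
    using V cols_dim[of V] by (simp add: orthonormal_basis_mat_def)
  have "x \<in> span S" using in_own_span[OF S] \<open>x \<in> S\<close> by blast
  also have "span S = span (set (cols V))"
    using V by (simp add: orthonormal_basis_mat_def vec_span_def)
  also have "\<dots> = span_list (cols V)" by (rule span_list_as_span[OF cols, symmetric])
  finally obtain c where "x = lincomb_list c (cols V)" by (auto simp: span_list_def)
  also have "\<dots> = mat_of_cols n (cols V) *\<^sub>v vec (length (cols V)) c"
    using cols by (intro lincomb_list_as_mat_mult) auto
  also have "mat_of_cols n (cols V) = V"
    using V mat_of_cols_cols[of V] by (simp add: orthonormal_basis_mat_def)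
  finally show ?thesis by (intro bexI[of _ "vec (length (cols V)) c"]) auto
qed

section \<open>Bounds for the gap\<close>

lemma sqnorm_cols_mat_adjoint_mult_vec:
  assumes "z \<in> carrier_vec n" "\<And>k. k \<in> {1..q} \<Longrightarrow> v k \<in> carrier_vec n"
  shows "vec_sqnorm (mat_adjoint (cols_mat n q v) *\<^sub>v z) = (\<Sum>k\<in>{1..q}. (cmod (z \<bullet>c v k))\<^sup>2)"
proof -
  have "mat_adjoint (cols_mat n q v) *\<^sub>v z = vec q (\<lambda>k. z \<bullet>c v (Suc k))"
    by (rule cols_mat_adjoint_mult_vec[OF assms])
  then have "vec_sqnorm (mat_adjoint (cols_mat n q v) *\<^sub>v z) = (\<Sum>k<q. (cmod (z \<bullet>c v (Suc k)))\<^sup>2)"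
    by (simp add: vec_sqnorm_def)
  also have "\<dots> = (\<Sum>k\<in>{1..q}. (cmod (z \<bullet>c v k))\<^sup>2)" by (rule sum_atLeast1_shift)
  finally show ?thesis .
qed

lemma cols_mat_mult_vec_coord:
  assumes "orthonormal_on n q v" "b \<in> carrier_vec q" "k < q"
  shows "(cols_mat n q v *\<^sub>v b) \<bullet>c v (Suc k) = b $ k"
proof -
  let ?V = "cols_mat n q v"
  have Vb: "?V *\<^sub>v b \<in> carrier_vec n" using assms(2) by (auto intro!: mult_mat_vec_carrier)
  have "b = mat_adjoint ?V *\<^sub>v (?V *\<^sub>v b)"
    using assms(2) orthonormal_on_adjoint[OF assms(1)]
    by (simp flip: assoc_mult_mat_vec[of _ q n _ q])
  also have "\<dots> = vec q (\<lambda>k. (?V *\<^sub>v b) \<bullet>c v (Suc k))"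
    by (rule cols_mat_adjoint_mult_vec[OF Vb orthonormal_onD(1)[OF assms(1)]])
  finally have "b $ k = vec q (\<lambda>k. (?V *\<^sub>v b) \<bullet>c v (Suc k)) $ k" by simp
  then show ?thesis using assms(3) by simp
qed

text \<open>The first \<open>q\<close> Ritz vectors see exactly the first \<open>q\<close>
  coordinates of \<open>gap_root l H *\<^sub>v x\<close>, so the projection restores what the square
  of the root subtracted there. The form becomes diagonal with entries \<open>coef\<close>, plus a
  nonnegative contribution of the Ritz vectors beyond \<open>q\<close>, which is absent for
  \<open>q = r\<close>.\<close>

lemma beta_gap_compression:
  assumes H: "H \<in> carrier_mat n n" "hermitian_mat H" and v: "lowest_eigenvectors H l v"
    and l: "1 \<le> l" "l < n" and V: "V \<in> carrier_mat n d" "mat_adjoint V * V = 1\<^sub>m d"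
    and range: "\<And>k. k \<in> {1..l} \<Longrightarrow> \<exists>c\<in>carrier_vec d. v k = V *\<^sub>v c"
    and w: "lowest_eigenvectors (mat_adjoint V * H * V) r w"
    and q: "q \<le> r" "r \<le> l" and gap: "eig H q < eig H (q + 1)"
  defines "\<beta> \<equiv> beta_gap l H (cols_mat n l v) (cols_mat n r (\<lambda>m. V *\<^sub>v w m))"
  shows "eig H (q + 1) - eig H 1 \<le> \<beta>" and "q = r \<Longrightarrow> \<beta> = eig H (q + 1) - eig H 1"
proof -
  define Vi where "Vi = cols_mat n l v"
  define U where "U = cols_mat n r (\<lambda>m. V *\<^sub>v w m)"
  note vD = lowest_eigenvectorsD[OF v H(1)]
  have Vi: "Vi \<in> carrier_mat n l" and U: "U \<in> carrier_mat n r" by (simp_all add: Vi_def U_def)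
  have "dim_row (mat_adjoint V * H * V) = d" using V by simp
  then have w_orth: "orthonormal_on d r w" using w by (simp add: lowest_eigenvectors_def)
  have Vw: "V *\<^sub>v w m \<in> carrier_vec n" if "m \<in> {1..r}" for m
    using V orthonormal_onD(1)[OF w_orth that] by auto
  have eigH: "eig H a \<le> eig H b" if "1 \<le> a" "a \<le> b" "b \<le> l + 1" for a b
    using eig_mono[OF H(1)] that l by simp
  then have le: "eig H k \<le> eig H (l + 1)" if "k \<in> {1..l}" for k using that by auto
  note rayleigh = beta_gap_rayleigh[OF l(1) Vi U le]
  define coef where "coef a = (if a < q then eig H (l + 1) - eig H 1 else eig H (a + 1) - eig H 1)" for a
  have form: "(\<Sum>a<l. coef a * (cmod (x $ a))\<^sup>2) \<le> gap_form l H Vi U x"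
    "q = r \<Longrightarrow> gap_form l H Vi U x = (\<Sum>a<l. coef a * (cmod (x $ a))\<^sup>2)"
    if x: "x \<in> carrier_vec l" for x
  proof -
    define b where "b = gap_root l H *\<^sub>v x"
    define z where "z = Vi *\<^sub>v b"
    have b: "b \<in> carrier_vec l" using x by (auto simp: b_def intro!: mult_mat_vec_carrier)
    have z: "z \<in> carrier_vec n" using Vi b by (auto simp: z_def)
    have "(\<Sum>m\<in>{1..q}. (cmod (z \<bullet>c (V *\<^sub>v w m)))\<^sup>2) = (\<Sum>k\<in>{1..q}. (cmod (z \<bullet>c v k))\<^sup>2)"
      by (rule compression_same_span[OF H v l(2) V range w q gap z])
    also have "\<dots> = (\<Sum>a<q. (cmod (z \<bullet>c v (Suc a)))\<^sup>2)" by (rule sum_atLeast1_shift[symmetric])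
    also have "\<dots> = (\<Sum>a<q. (eig H (l + 1) - eig H (a + 1)) * (cmod (x $ a))\<^sup>2)"
    proof (intro sum.cong refl)
      fix a assume "a \<in> {..<q}"
      then have a: "a < l" using q by simp
      have "z \<bullet>c v (Suc a) = b $ a"
        unfolding z_def Vi_def by (rule cols_mat_mult_vec_coord[OF vD(1) b a])
      then show "(cmod (z \<bullet>c v (Suc a)))\<^sup>2 = (eig H (l + 1) - eig H (a + 1)) * (cmod (x $ a))\<^sup>2"
        using cmod_gap_root_mult_vec[OF x a, of H] le[of "a + 1"] a by (simp add: b_def)
    qed
    also have "\<dots> = (\<Sum>a<l. if a < q then (eig H (l + 1) - eig H (a + 1)) * (cmod (x $ a))\<^sup>2 else 0)"
      by (rule sum.mono_neutral_cong_left) (use q in auto)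
    finally have first: "(\<Sum>m\<in>{1..q}. (cmod (z \<bullet>c (V *\<^sub>v w m)))\<^sup>2)
        = (\<Sum>a<l. if a < q then (eig H (l + 1) - eig H (a + 1)) * (cmod (x $ a))\<^sup>2 else 0)" .
    have Uz: "vec_sqnorm (mat_adjoint U *\<^sub>v z) = (\<Sum>m\<in>{1..r}. (cmod (z \<bullet>c (V *\<^sub>v w m)))\<^sup>2)"
      unfolding U_def by (rule sqnorm_cols_mat_adjoint_mult_vec[OF z Vw])
    have "gap_form l H Vi U x = (\<Sum>a<l. (eig H (a + 1) - eig H 1) * (cmod (x $ a))\<^sup>2)
        + vec_sqnorm (mat_adjoint U *\<^sub>v z)"
      unfolding z_def b_def by (rule gap_form_sum[OF x le])
    moreover have "(\<Sum>a<l. coef a * (cmod (x $ a))\<^sup>2)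
        = (\<Sum>a<l. (eig H (a + 1) - eig H 1) * (cmod (x $ a))\<^sup>2)
          + (\<Sum>m\<in>{1..q}. (cmod (z \<bullet>c (V *\<^sub>v w m)))\<^sup>2)"
      unfolding first sum.distrib[symmetric] by (intro sum.cong) (auto simp: coef_def algebra_simps)
    moreover have "(\<Sum>m\<in>{1..q}. (cmod (z \<bullet>c (V *\<^sub>v w m)))\<^sup>2)
        \<le> (\<Sum>m\<in>{1..r}. (cmod (z \<bullet>c (V *\<^sub>v w m)))\<^sup>2)"
      using q by (intro sum_mono2) auto
    ultimately show "(\<Sum>a<l. coef a * (cmod (x $ a))\<^sup>2) \<le> gap_form l H Vi U x"
      "q = r \<Longrightarrow> gap_form l H Vi U x = (\<Sum>a<l. coef a * (cmod (x $ a))\<^sup>2)"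
      using Uz by simp_all
  qed
  have coef: "eig H (q + 1) - eig H 1 \<le> coef a" if "a < l" for a
    using that q eigH[of "q + 1" "l + 1"] eigH[of "q + 1" "a + 1"] by (auto simp: coef_def)
  obtain x where x: "x \<in> carrier_vec l" "0 < vec_sqnorm x" "gap_form l H Vi U x = \<beta> * vec_sqnorm x"
    using rayleigh(2) unfolding \<beta>_def Vi_def U_def by blast
  have "dim_vec x = l" using x(1) by simp
  then have "(eig H (q + 1) - eig H 1) * vec_sqnorm x \<le> (\<Sum>a<l. coef a * (cmod (x $ a))\<^sup>2)"
    unfolding vec_sqnorm_def sum_distrib_left
    by (simp only:) (intro sum_mono mult_right_mono coef, auto)
  also note form(1)[OF x(1)]
  finally have "(eig H (q + 1) - eig H 1) * vec_sqnorm x \<le> \<beta> * vec_sqnorm x" by (simp only: x(3))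
  then show ge: "eig H (q + 1) - eig H 1 \<le> \<beta>" using x(2) by simp
  assume "q = r"
  \<comment> \<open>An index at which \<open>coef\<close> takes its least value
    \<open>eig H (q + 1) - eig H 1\<close>. This is \<open>r\<close>, unless \<open>r = l\<close>:
    then \<open>r\<close> is out of range, but all coefficients are equal and the last index will
    do.\<close>
  define a where "a = (if r = l then l - 1 else r)"
  have a: "a < l" "coef a = eig H (q + 1) - eig H 1"
    using \<open>q = r\<close> l q by (auto simp: a_def coef_def)
  define e :: "complex vec" where "e = unit_vec l a"
  have e: "e \<in> carrier_vec l" by (simp add: e_def)
  have sum_e: "(\<Sum>k<l. g k * (cmod (e $ k))\<^sup>2) = g a" for g :: "nat \<Rightarrow> real"
  proof -
    have "(\<Sum>k<l. g k * (cmod (e $ k))\<^sup>2) = (\<Sum>k<l. if k = a then g a else 0)"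
      using a(1) by (intro sum.cong) (auto simp: e_def)
    then show ?thesis using a(1) by simp
  qed
  have "vec_sqnorm e = 1" using sum_e[of "\<lambda>_. 1"] e by (simp add: vec_sqnorm_def)
  then have "\<beta> \<le> eig H (q + 1) - eig H 1"
    using rayleigh(1)[OF _ e] form(2)[OF e \<open>q = r\<close>] sum_e[of coef] a(2)
    by (simp add: \<beta>_def Vi_def U_def)
  with ge show "\<beta> = eig H (q + 1) - eig H 1" by simp
qed

text \<open>Write \<open>a = V\<^sup>* u\<close>, \<open>R = gap_root\<close>, and \<open>s = \<parallel>R a\<parallel>\<^sup>2\<close>. Testing the gap matrix with \<open>R a\<close> and Bessel's
  inequality for the columns of \<open>U\<close> together with \<open>u\<close> give \<open>\<beta> s \<le> (\<lambda>\<^bsub>l+1\<^esub> - \<lambda>\<^sub>1) s - s\<^sup>2\<close>.\<close>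

lemma beta_gap_le_rayleigh:
  assumes H: "H \<in> carrier_mat n n" "hermitian_mat H" and v: "lowest_eigenvectors H l v"
    and l: "1 \<le> l" "l < n" and y: "orthonormal_on n r y"
    and u: "u \<in> carrier_vec n" "vec_sqnorm u = 1" and orth: "\<And>m. m \<in> {1..r} \<Longrightarrow> u \<bullet>c y m = 0"
  shows "eig H 1 + beta_gap l H (cols_mat n l v) (cols_mat n r y) \<le> Re ((H *\<^sub>v u) \<bullet>c u)"
proof -
  define V where "V = cols_mat n l v"
  define U where "U = cols_mat n r y"
  define \<beta> where "\<beta> = beta_gap l H V U"
  define R where "R = gap_root l H"
  define c where "c = eig H (l + 1) - eig H 1"
  note vD = lowest_eigenvectorsD[OF v H(1)]
  have V: "V \<in> carrier_mat n l" and U: "U \<in> carrier_mat n r" and R: "R \<in> carrier_mat l l"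
    by (simp_all add: V_def U_def R_def)
  have VV: "mat_adjoint V * V = 1\<^sub>m l" unfolding V_def by (rule orthonormal_on_adjoint[OF vD(1)])
  have le: "eig H k \<le> eig H (l + 1)" if "k \<in> {1..l}" for k
    using eig_mono[OF H(1), of k "l + 1"] that l by simp
  have ray: "\<beta> * vec_sqnorm x \<le> gap_form l H V U x" if "x \<in> carrier_vec l" for x
    unfolding \<beta>_def by (rule beta_gap_rayleigh(1)[OF l(1) V U le that])
  have form: "gap_form l H V U x + (cmod ((R *\<^sub>v x) \<bullet>c (mat_adjoint V *\<^sub>v u)))\<^sup>2 \<le> c * vec_sqnorm x"
    if x: "x \<in> carrier_vec l" for x
  proof -
    define z where "z = V *\<^sub>v (R *\<^sub>v x)"
    have Rx: "R *\<^sub>v x \<in> carrier_vec l" using R x by auto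
    have z: "z \<in> carrier_vec n" using V Rx by (auto simp: z_def)
    \<comment> \<open>Appending \<open>u\<close> to the columns of \<open>U\<close> makes Bessel
      yield the extra square \<open>(cmod (z \<bullet>c u))\<^sup>2\<close> on top of the projection
      onto the range of \<open>U\<close>.\<close>
    have yu: "orthonormal_on n (Suc r) (y(Suc r := u))"
      by (rule orthonormal_on_snoc[OF y u orth])
    have "(\<Sum>m\<in>{1..Suc r}. (cmod (z \<bullet>c (y(Suc r := u)) m))\<^sup>2)
        = (\<Sum>m\<in>{1..r}. (cmod (z \<bullet>c y m))\<^sup>2) + (cmod (z \<bullet>c u))\<^sup>2"
      by (simp add: sum.cl_ivl_Suc)
    then have "(\<Sum>m\<in>{1..r}. (cmod (z \<bullet>c y m))\<^sup>2) + (cmod (z \<bullet>c u))\<^sup>2 \<le> vec_sqnorm z"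
      using bessel[OF yu z] by simp
    moreover have "vec_sqnorm (mat_adjoint U *\<^sub>v z) = (\<Sum>m\<in>{1..r}. (cmod (z \<bullet>c y m))\<^sup>2)"
      unfolding U_def by (rule sqnorm_cols_mat_adjoint_mult_vec[OF z orthonormal_onD(1)[OF y]])
    moreover have "vec_sqnorm z = vec_sqnorm (R *\<^sub>v x)"
      unfolding z_def by (rule isometry_sqnorm[OF V VV Rx])
    moreover have "z \<bullet>c u = (R *\<^sub>v x) \<bullet>c (mat_adjoint V *\<^sub>v u)"
      unfolding z_def by (rule cscalar_prod_adjoint[OF V Rx u(1)])
    ultimately show ?thesis by (simp add: gap_form_def c_def z_def R_def)
  qed
  define a where "a = mat_adjoint V *\<^sub>v u"
  define s where "s = vec_sqnorm (R *\<^sub>v a)"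
  have a: "a \<in> carrier_vec l" using mat_adjoint_carrier[OF V] u by (auto simp: a_def)
  have Ra: "R *\<^sub>v a \<in> carrier_vec l" using R a by auto
  have "(R *\<^sub>v (R *\<^sub>v a)) \<bullet>c a = (R *\<^sub>v a) \<bullet>c (R *\<^sub>v a)"
    using cscalar_prod_adjoint[OF R Ra a] by (simp add: R_def)
  then have "\<beta> * s + s\<^sup>2 \<le> c * s"
    using form[OF Ra] ray[OF Ra] by (simp add: a_def[symmetric] cscalar_prod_self s_def)
  then have *: "(\<beta> + s) * s \<le> c * s" by (simp add: power2_eq_square distrib_right)
  \<comment> \<open>For \<open>s = 0\<close> the quadratic inequality says nothing about
    \<open>\<beta>\<close>; evaluating the form at its minimiser gives
    \<open>\<beta> \<le> c\<close> independently.\<close>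
  obtain x where x: "x \<in> carrier_vec l" "0 < vec_sqnorm x" "gap_form l H V U x = \<beta> * vec_sqnorm x"
    using beta_gap_rayleigh(2)[OF l(1) V U le] unfolding \<beta>_def by blast
  have "gap_form l H V U x \<le> c * vec_sqnorm x"
    using form[OF x(1)] zero_le_power2[of "cmod ((R *\<^sub>v x) \<bullet>c (mat_adjoint V *\<^sub>v u))"] by linarith
  then have "\<beta> \<le> c" using x by simp
  have "\<beta> + s \<le> c"
  proof (cases "s = 0")
    case False
    then have "0 < s" using vec_sqnorm_nonneg[of "R *\<^sub>v a"] unfolding s_def by linarith
    with * show ?thesis by (rule mult_right_le_imp_le)
  qed (use \<open>\<beta> \<le> c\<close> in simp)
  have "a = vec l (\<lambda>k. u \<bullet>c v (Suc k))"
    unfolding a_def V_def by (rule cols_mat_adjoint_mult_vec[OF u(1) orthonormal_onD(1)[OF vD(1)]])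
  then have "s = (\<Sum>k<l. (eig H (l + 1) - eig H (Suc k)) * (cmod (u \<bullet>c v (Suc k)))\<^sup>2)"
    using vec_sqnorm_gap_root[OF a le] by (simp add: s_def R_def)
  also have "\<dots> = (\<Sum>k\<in>{1..l}. (eig H (l + 1) - eig H k) * (cmod (u \<bullet>c v k))\<^sup>2)"
    by (rule sum_atLeast1_shift)
  \<comment> \<open>For a unit vector \<open>u\<close> the lower bound in
    \<open>rayleigh_lowest\<close> rearranges to exactly \<open>eig H (l + 1) - s\<close>.\<close>
  finally have "eig H (l + 1) - s \<le> Re ((H *\<^sub>v u) \<bullet>c u)"
    using rayleigh_lowest[OF H v l(2) u(1)] u(2)
    by (simp add: left_diff_distrib sum_subtractf sum_distrib_left[symmetric] right_diff_distrib)
  with \<open>\<beta> + s \<le> c\<close> show ?thesis by (simp add: c_def \<beta>_def V_def U_def)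
qed

section \<open>The parameter-dependent family\<close>

lemma A_of_carrier [simp]: "A_of n \<theta> A \<mu> \<in> carrier_mat n n"
  by (simp add: A_of_def)

lemma hermitian_A_of:
  assumes "\<And>m. A m \<in> carrier_mat n n" "\<And>m. hermitian_mat (A m)"
  shows "hermitian_mat (A_of n \<theta> A \<mu>)"
proof -
  have "cnj (A m $$ (k, i)) = A m $$ (i, k)" if "i < n" "k < n" for i k m
    using that assms(1)[of m] assms(2)[of m] index_mat_adjoint[of i "A m" k]
    by (simp add: hermitian_mat_def)
  then show ?thesis
    unfolding hermitian_mat_def by (intro eq_matI) (auto simp: A_of_def)
qed

text \<open>The form is linear in the matrix. The vector of Rayleigh quotients of the
  \<open>A m\<close> thus turns lower bounds on the form of \<open>A_of\<close> into the linear
  constraints of \<open>Y_LB\<close>.\<close>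

lemma cscalar_prod_A_of:
  assumes "\<And>m. A m \<in> carrier_mat n n" "x \<in> carrier_vec n"
  shows "Re ((A_of n \<theta> A \<mu> *\<^sub>v x) \<bullet>c x) = inner (theta_vec \<theta> \<mu>) (\<chi> m. Re ((A m *\<^sub>v x) \<bullet>c x))"
proof -
  have quad: "(M *\<^sub>v x) \<bullet>c x = (\<Sum>i<n. \<Sum>k<n. M $$ (i, k) * x $ k * cnj (x $ i))"
    if "M \<in> carrier_mat n n" for M
    using that assms(2)
    by (simp add: cscalar_prod_sum[of _ n] mult_mat_vec_sum sum_distrib_right del: index_mult_mat_vec)
  have "(A_of n \<theta> A \<mu> *\<^sub>v x) \<bullet>c x
      = (\<Sum>i<n. \<Sum>k<n. \<Sum>m\<in>UNIV. complex_of_real (\<theta> m \<mu>) * (A m $$ (i, k) * x $ k * cnj (x $ i)))"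
    unfolding quad[OF A_of_carrier] by (simp add: A_of_def sum_distrib_left sum_distrib_right mult_ac)
  also have "\<dots> = (\<Sum>m\<in>UNIV. \<Sum>i<n. \<Sum>k<n. complex_of_real (\<theta> m \<mu>) * (A m $$ (i, k) * x $ k * cnj (x $ i)))"
    by (simp only: sum.swap[where B = UNIV])
  also have "\<dots> = (\<Sum>m\<in>UNIV. complex_of_real (\<theta> m \<mu>) * ((A m *\<^sub>v x) \<bullet>c x))"
    by (simp add: quad[OF assms(1)] sum_distrib_left)
  finally show ?thesis by (simp add: inner_vec_def theta_vec_def)
qed

text \<open>The feasible set is a compact box cut by closed half-spaces, so a continuous function
  attains its infimum there and the \<open>LEAST\<close> in \<open>eta\<close> is a true
  minimum.\<close>

lemma eta_attained:
  assumes "Y_LB n l r j \<theta> A pts v V w \<mu> \<noteq> {}"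
  shows "\<exists>y\<in>Y_LB n l r j \<theta> A pts v V w \<mu>. eta n l r j \<theta> A pts v V w \<mu> = inner (theta_vec \<theta> \<mu>) y"
proof -
  let ?Y = "Y_LB n l r j \<theta> A pts v V w \<mu>"
  have "?Y = B_box A \<inter> (\<Inter>i\<in>{1..j}. {y. inner (theta_vec \<theta> (pts i)) y
      \<ge> eig (A_of n \<theta> A (pts i)) 1 + beta n l r \<theta> A pts v V w i \<mu>})"
    by (auto simp: Y_LB_def)
  then have "compact ?Y"
    by (simp only: B_box_def) (intro compact_Int_closed compact_cbox closed_INT ballI closed_halfspace_ge)
  moreover have "continuous_on ?Y (inner (theta_vec \<theta> \<mu>))" by (intro continuous_intros)
  ultimately obtain y where y: "y \<in> ?Y" "\<forall>y'\<in>?Y. inner (theta_vec \<theta> \<mu>) y \<le> inner (theta_vec \<theta> \<mu>) y'"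
    using continuous_attains_inf[OF _ assms, of "inner (theta_vec \<theta> \<mu>)"] by blast
  then have "eta n l r j \<theta> A pts v V w \<mu> = inner (theta_vec \<theta> \<mu>) y"
    unfolding eta_def by (intro Least_equality) auto
  then show ?thesis using y(1) by blast
qed

text \<open>If the first two list entries agreed, their common value would be at least a double root
  of the characteristic polynomial.\<close>

lemma simple_eigenvalue_eig_less:
  assumes M: "M \<in> carrier_mat n n" "hermitian_mat M" and "2 \<le> n"
    and simple: "simple_eigenvalue M (complex_of_real (eig M 1))"
  shows "eig M 1 < eig M 2"
proof (rule ccontr)
  assume "\<not> eig M 1 < eig M 2"
  then have eq: "eig M 2 = eig M 1" using eig_mono[OF M(1), of 1 2] \<open>2 \<le> n\<close> by simp
  obtain u f where uf: "eigenbasis M n u f"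
    using eigenbasis_extend[OF M, of 0 "\<lambda>_. 0\<^sub>v n" "\<lambda>_. 0"] by (auto simp: orthonormal_on_def)
  let ?L = "eigs_list M"
  have "mset (map f [1..<Suc n]) = mset ?L" by (simp only: eigs_list_eigenbasis[OF uf] mset_sort)
  \<comment> \<open>The list records real parts only; an eigenbasis shows that the roots are real,
    so root multiplicities can be read off the list.\<close>
  then have "proots (char_poly M) = image_mset complex_of_real (mset ?L)"
    unfolding char_poly_eigenbasis[OF uf] proots_prod_list_linear map_map[symmetric]
    by (simp only: mset_map)
  then have "count (image_mset complex_of_real (mset ?L)) (complex_of_real (eig M 1)) = 1"
    using simple degree_monic_char_poly[OF M(1)]
    by (metis count_proots coeff_0 simple_eigenvalue_def zero_neq_one)
  moreover obtain a b xs where "?L = a # b # xs"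
    using length_eigs_list[OF M(1)] \<open>2 \<le> n\<close>
    by (metis Suc_le_length_iff numeral_2_eq_2)
  ultimately show False using eq by (simp add: eig_eigs_list)
qed

theorem lemma2:
  fixes D :: "(real ^ 'p) set"
    and n l r j :: nat
    and \<theta> :: "'k::finite \<Rightarrow> real ^ 'p \<Rightarrow> real"
    and A :: "'k \<Rightarrow> complex mat"
    and pts :: "nat \<Rightarrow> real ^ 'p"
    and v :: "nat \<Rightarrow> nat \<Rightarrow> complex vec"
    and V :: "complex mat"
    and w :: "real ^ 'p \<Rightarrow> nat \<Rightarrow> complex vec"
  assumes "compact D"
    and "\<And>m. A m \<in> carrier_mat n n"
    and "\<And>m. hermitian_mat (A m)"
    and "\<And>m. real_analytic (\<theta> m)"
    and "1 \<le> r" and "r \<le> l" and "l < n"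
    and "\<And>i. i \<in> {1..j} \<Longrightarrow> pts i \<in> D"
    and "\<And>i. i \<in> {1..j} \<Longrightarrow> lowest_eigenvectors (A_of n \<theta> A (pts i)) l (v i)"
    and "orthonormal_basis_mat n V (vec_span n {v i k | i k. i \<in> {1..j} \<and> k \<in> {1..l}})"
    and "\<And>\<mu>. \<mu> \<in> D \<Longrightarrow> lowest_eigenvectors (mat_adjoint V * A_of n \<theta> A \<mu> * V) r (w \<mu>)"
  shows "(\<forall>\<mu>\<in>D. \<forall>i\<in>{1..j}. beta n l r \<theta> A pts v V w i \<mu> \<ge> 0)
    \<and> (\<forall>i\<in>{1..j}. eta n l r j \<theta> A pts v V w (pts i) \<ge> eig (A_of n \<theta> A (pts i)) 1)
    \<and> (\<forall>i\<in>{1..j}.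
         simple_eigenvalue (A_of n \<theta> A (pts i)) (complex_of_real (eig (A_of n \<theta> A (pts i)) 1)) \<longrightarrow>
         beta n l r \<theta> A pts v V w i (pts i) > 0)
    \<and> (\<forall>i\<in>{1..j}.
         simple_eigenvalue (A_of n \<theta> A (pts i)) (complex_of_real (eig (A_of n \<theta> A (pts i)) 1)) \<longrightarrow>
         eta n l r j \<theta> A pts v V w (pts i) > eig (A_of n \<theta> A (pts i)) 1)
    \<and> (\<forall>i\<in>{1..j}.
         eig (A_of n \<theta> A (pts i)) (r + 1) > eig (A_of n \<theta> A (pts i)) r \<longrightarrow>
         beta n l r \<theta> A pts v V w i (pts i)
           = eig (A_of n \<theta> A (pts i)) (r + 1) - eig (A_of n \<theta> A (pts i)) 1
         \<and> eig (A_of n \<theta> A (pts i)) (r + 1) - eig (A_of n \<theta> A (pts i)) 1 > 0)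
    \<and> (\<forall>i\<in>{1..j}.
         eig (A_of n \<theta> A (pts i)) (r + 1) > eig (A_of n \<theta> A (pts i)) r \<longrightarrow>
         eta n l r j \<theta> A pts v V w (pts i) \<ge> eig (A_of n \<theta> A (pts i)) (r + 1))"
proof -
  let ?H = "A_of n \<theta> A"
  let ?\<beta> = "beta n l r \<theta> A pts v V w"
  let ?\<eta> = "eta n l r j \<theta> A pts v V w"
  note herm = hermitian_A_of[OF assms(2,3), of \<theta>]
  have l: "1 \<le> l" using assms(5,6) by simp
  define d where "d = dim_col V"
  have V: "V \<in> carrier_mat n d" "mat_adjoint V * V = 1\<^sub>m d"
    using assms(10) by (auto simp: orthonormal_basis_mat_def d_def)
  have v: "orthonormal_on n l (v i)" if "i \<in> {1..j}" for i
    using lowest_eigenvectorsD(1)[OF assms(9)[OF that] A_of_carrier] .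
  have "{v i k | i k. i \<in> {1..j} \<and> k \<in> {1..l}} \<subseteq> carrier_vec n"
    using orthonormal_onD(1)[OF v] by blast
  from orthonormal_basis_mat_range[OF assms(10) this]
  have range: "\<exists>c\<in>carrier_vec d. v i k = V *\<^sub>v c" if "i \<in> {1..j}" "k \<in> {1..l}" for i k
    using that unfolding d_def by blast
  have y: "orthonormal_on n r (\<lambda>k. V *\<^sub>v w \<mu> k)" if "\<mu> \<in> D" for \<mu>
    using isometry_orthonormal_on[OF V, of r "w \<mu>"] assms(11)[OF that]
    by (simp add: lowest_eigenvectors_def d_def)
  have \<beta>: "?\<beta> i \<mu> = beta_gap l (?H (pts i)) (cols_mat n l (v i)) (cols_mat n r (\<lambda>k. V *\<^sub>v w \<mu> k))" for i \<mu>
    by (simp add: beta_def U_of_def)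
  have nonneg: "0 \<le> ?\<beta> i \<mu>" for i \<mu>
    unfolding \<beta> by (rule beta_gap_nonneg[OF l _ _ A_of_carrier assms(7)]) auto
  \<comment> \<open>Kept for general \<open>q\<close>: the value \<open>q = 1\<close> handles simple
    lowest eigenvalues, and \<open>q = r\<close> gives the exact gap.\<close>
  have gap: "eig (?H (pts i)) (q + 1) - eig (?H (pts i)) 1 \<le> ?\<beta> i (pts i)"
    "q = r \<Longrightarrow> ?\<beta> i (pts i) = eig (?H (pts i)) (q + 1) - eig (?H (pts i)) 1"
    if i: "i \<in> {1..j}" and q: "q \<le> r" "eig (?H (pts i)) q < eig (?H (pts i)) (q + 1)" for i q
    unfolding \<beta>
    using beta_gap_compression[OF A_of_carrier herm assms(9)[OF i] l assms(7) V range[OF i]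
        assms(11)[OF assms(8)[OF i]] q(1) assms(6) q(2)] by blast+
  have eta_ge: "eig (?H (pts i)) 1 + ?\<beta> i (pts i) \<le> ?\<eta> (pts i)" if i: "i \<in> {1..j}" for i
  proof -
    have \<mu>: "pts i \<in> D" by (rule assms(8)[OF i])
    have "r < n" using assms(6,7) by simp
    then obtain u where u: "u \<in> carrier_vec n" "vec_sqnorm u = 1"
      "\<forall>k\<in>{1..r}. u \<bullet>c (V *\<^sub>v w (pts i) k) = 0"
      using exists_unit_orthogonal[of r n "\<lambda>k. V *\<^sub>v w (pts i) k"] orthonormal_onD(1)[OF y[OF \<mu>]] by blast
    \<comment> \<open>All constraints at \<open>pts i\<close> involve the same matrix
      \<open>U\<close>, so one \<open>u\<close> orthogonal to its columns satisfies the constraint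
      of every index \<open>i'\<close>.\<close>
    have "(\<chi> m. Re ((A m *\<^sub>v u) \<bullet>c u)) \<in> Y_LB n l r j \<theta> A pts v V w (pts i)"
      unfolding Y_LB_def
    proof (intro CollectI conjI ballI)
      show "(\<chi> m. Re ((A m *\<^sub>v u) \<bullet>c u)) \<in> B_box A"
        using hermitian_lambda_min(2,3)[OF assms(2,3) _ u(1)] assms(7) u(2)
        by (simp add: B_box_def mem_box_cart)
      fix i' assume i': "i' \<in> {1..j}"
      show "eig (?H (pts i')) 1 + ?\<beta> i' (pts i) \<le> inner (theta_vec \<theta> (pts i')) (\<chi> m. Re ((A m *\<^sub>v u) \<bullet>c u))"
        unfolding \<beta> cscalar_prod_A_of[OF assms(2) u(1), symmetric]
        by (rule beta_gap_le_rayleigh[OF A_of_carrier herm assms(9)[OF i'] l assms(7) y[OF \<mu>] u(1,2)])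
          (use u(3) in blast)
    qed
    then have "Y_LB n l r j \<theta> A pts v V w (pts i) \<noteq> {}" by blast
    \<comment> \<open>At \<open>pts i\<close>, constraint number \<open>i\<close> bounds the
      objective itself from below.\<close>
    from eta_attained[OF this] i show ?thesis unfolding Y_LB_def by auto
  qed
  have simple: "0 < ?\<beta> i (pts i)"
    if i: "i \<in> {1..j}" and "simple_eigenvalue (?H (pts i)) (complex_of_real (eig (?H (pts i)) 1))" for i
  proof -
    have "eig (?H (pts i)) 1 < eig (?H (pts i)) (1 + 1)"
      using simple_eigenvalue_eig_less[OF A_of_carrier herm _ that(2)] l assms(7)
      by (simp add: numeral_2_eq_2)
    with gap(1)[OF i assms(5) this] show ?thesis by linarith
  qed
  have r_gap: "?\<beta> i (pts i) = eig (?H (pts i)) (r + 1) - eig (?H (pts i)) 1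
      \<and> eig (?H (pts i)) (r + 1) - eig (?H (pts i)) 1 > 0"
    if i: "i \<in> {1..j}" and less: "eig (?H (pts i)) r < eig (?H (pts i)) (r + 1)" for i
    \<comment> \<open>Positivity follows from
      \<open>eig (?H (pts i)) 1 \<le> eig (?H (pts i)) r\<close>, by \<open>1 \<le> r\<close>, and
      the strict gap after \<open>r\<close>.\<close>
    using gap(2)[OF i order_refl less refl] less
      eig_mono[OF A_of_carrier order_refl assms(5), of n \<theta> A "pts i"] assms(6,7) by simp
  show ?thesis
  proof (intro conjI ballI impI)
    fix i assume i: "i \<in> {1..j}"
    show "eig (?H (pts i)) 1 \<le> ?\<eta> (pts i)" using eta_ge[OF i] nonneg[of i "pts i"] by linarith
    assume "simple_eigenvalue (?H (pts i)) (complex_of_real (eig (?H (pts i)) 1))"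
    from simple[OF i this] show "0 < ?\<beta> i (pts i)" "eig (?H (pts i)) 1 < ?\<eta> (pts i)"
      using eta_ge[OF i] by linarith+
  next
    fix i assume i: "i \<in> {1..j}" and "eig (?H (pts i)) r < eig (?H (pts i)) (r + 1)"
    note g = r_gap[OF this]
    then show "?\<beta> i (pts i) = eig (?H (pts i)) (r + 1) - eig (?H (pts i)) 1"
      "0 < eig (?H (pts i)) (r + 1) - eig (?H (pts i)) 1"
      by simp_all
    show "eig (?H (pts i)) (r + 1) \<le> ?\<eta> (pts i)" using eta_ge[OF i] g by linarith
  qed (rule nonneg)
qed

end
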